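(* Let $y_i,y_j,y_k,y_l,y_m\in\mathbb{C}^*$, set $x_s:=y_s^N$, assume $x_i\ne-1$, and let $v_i,v_j,v_k,v_l,v_m\in\mathbb{C}^*$ satisfy $v_i^N=x_i^{-1}$, $v_j^N=(1+x_i)x_j$, $v_k^N=(1+x_i^{-1})^{-1}x_k$, $v_l^N=(1+x_i)x_l$, $v_m^N=(1+x_i^{-1})^{-1}x_m$ and $y_iy_jy_ky_ly_m=v_iv_jv_kv_lv_m$. Let $z_i\in\mathbb{Z}_N$ be defined by $v_i=q^{2z_i}y_i^{-1}$. Let $\rho_\lambda:\mathcal{T}^q_\lambda\to\mathrm{End}(\mathbb{C}^N\otimes\mathbb{C}^N)$ and $\rho_{\lambda'}:\mathcal{T}^q_{\lambda'}\to\mathrm{End}(\mathbb{C}^N\otimes\mathbb{C}^N)$ be the local representations $$\rho_\lambda(X_i)=y_iB_2\otimes B_1,\ \rho_\lambda(X_j)=y_jB_1\otimes I,\ \rho_\lambda(X_k)=y_kI\otimes B_2,\ \rho_\lambda(X_l)=y_lI\otimes B_3,\ \rho_\lambda(X_m)=y_mB_3\otimes I,$$ $$\rho_{\lambda'}(X'_i)=v_iB_3\otimes B_2,\ \rho_{\lambda'}(X'_j)=v_jB_1\otimes I,\ \rho_{\lambda'}(X'_k)=v_kB_2\otimes I,\ \rho_{\lambda'}(X'_l)=v_lI\otimes B_3,\ \rho_{\lambda'}(X'_m)=v_mI\otimes B_1.$$ Define, for $a\in\mathbb{N}$, $$f(a):=\left(\frac{y_j}{v_j}\right)^a\prod_{u=1}^a\bigl(1+y_iq^{1-2(u+z_i)}\bigr)\quad(f(0)=1),\qquad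 p(x):=\sum_{d=0}^{N-1}\left(\frac{y_ly_ky_i}{v_lv_k}\right)^dx^d .$$ Then the linear isomorphism $L:\mathbb{C}^N\otimes\mathbb{C}^N\to\mathbb{C}^N\otimes\mathbb{C}^N$, unique up to scalar multiplication, satisfying $$L\circ\rho_{\lambda'}(X')\circ L^{-1}=(\rho_\lambda\circ\Phi^q_{\lambda\lambda'})(X')\qquad\forall X'\in\mathcal{T}^q_{\lambda'}$$ is given, up to a non-zero scalar, by $L(e_s\otimes e_t)=\sum_{b,c=0}^{N-1}L^{b,c}_{s,t}\,e_b\otimes e_c$ with $$L^{b,c}_{s,t}=q^{-s^2+2z_i(b-c-z_i)+2bc}\left(\frac{y_jy_ky_i}{v_jv_k}\right)^{c+z_i}p\bigl(q^{2(s+t-c-z_i)}\bigr)\left(\sum_{a=0}^{N-1}q^{2a(b-s)}f(a)\right)$$ for $s,t,b,c\in\{0,\dots,N-1\}$, where $\{e_0,\dots,e_{N-1}\}$ is the canonical basis of $\mathbb{C}^N$.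
   Context: $N\ge1$ is an integer and $q\in\mathbb{C}^*$ is a primitive $N$-th root of $(-1)^{N+1}$, i.e. $q^N=(-1)^{N+1}$ and $q^2$ has order $N$; $\mathbb{Z}_N=\mathbb{Z}/N$. The endomorphisms $B_1,B_2,B_3$ of $\mathbb{C}^N$ are (indices of basis vectors mod $N$, $0\le k\le N-1$) $B_1e_k=q^{2k}e_k$, $B_2e_k=e_{k+1}$, $B_3e_k=q^{1-2k}e_{k-1}$; $I$ is the identity. $\lambda,\lambda'$ are the two ideal triangulations of an ideal square with boundary edges $j,k,l,m$ in clockwise order: $\lambda$ has diagonal $i$ separating $\{j,m\}$ from $\{k,l\}$, its triangles having sides in clockwise order $(j,i,m)$ and $(i,k,l)$; $\lambda'$ has the other diagonal (also indexed $i$), its triangles having sides in clockwise order $(j,k,i)$ and $(m,i,l)$. The Chekhov-Fock algebra $\mathcal{T}^q_\lambda$ is the $\mathbb{C}$-algebra generated by $X_s^{\pm1}$, $s\in\{i,j,k,l,m\}$, with relations $X_aX_b=q^{2\sigma_{ab}}X_bX_a$, where $\sigma$ is antisymmetric and each triangle with clockwise sides $(a,b,c)$ contributes $+1$ to $\sigma_{ab},\sigma_{bc},\sigma_{ca}$ (and $-1$ to the transposed entries); $\mathcal{T}^q_{\lambda'}$ is defined in the same way with generators $X_s'^{\pm1}$. The isomorphism of fraction rings $\Phi^q_{\lambda\lambda'}$ is $X'_i\mapsto X_i^{-1}$, $X'_j\mapsto(1+qX_i)X_j$, $X'_k\mapsto(1+qX_i^{-1})^{-1}X_k$, $X'_l\mapsto(1+qX_i)X_l$,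 $X'_m\mapsto(1+qX_i^{-1})^{-1}X_m$, and $(\rho_\lambda\circ\Phi^q_{\lambda\lambda'})(X'_s)$ is obtained by substituting $\rho_\lambda(X_\bullet)$ in these expressions (the inverted operators are invertible since $x_i\ne-1$). *)

theory Defs
  imports
    "HOL-Algebra.QuotRing"
    "HOL-Library.Poly_Mapping"
    "Jordan_Normal_Form.Matrix"
begin

section \<open>The free algebra on invertible symbols\<close>

datatype 's letter = Pos 's | Neg 's

datatype 's word = Word "'s letter list"

fun letters :: "'s word \<Rightarrow> 's letter list" where
  "letters (Word w) = w"

instantiation word :: (type) monoid_add
begin

definition zero_word :: "'a word" where
  "zero_word = Word []"

definition plus_word :: "'a word \<Rightarrow> 'a word \<Rightarrow> 'a word" where
  "plus_word u w = Word (letters u @ letters w)"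

instance
proof
  fix a b c :: "'a word"
  show "a + b + c = a + (b + c)" by (simp add: plus_word_def)
  show "0 + a = a" by (cases a) (simp add: plus_word_def zero_word_def)
  show "a + 0 = a" by (cases a) (simp add: plus_word_def zero_word_def)
qed

end

text \<open>
  Words form a monoid under concatenation (written additively), so that finitely supported
  functions on words, with the convolution product of \<^theory>\<open>HOL-Library.Poly_Mapping\<close>, are the
  free unital associative \<open>\<complex>\<close>-algebra on the letters. A letter \<open>Neg s\<close> becomes the inverse of
  \<open>Pos s\<close> only in the quotient \<open>cf_algebra\<close> below.
\<close>

type_synonym 's free_alg = "'s word \<Rightarrow>\<^sub>0 complex"

definition letter_elem :: "'s letter \<Rightarrow> 's free_alg" where
  "letter_elem a = Poly_Mapping.single (Word [a]) 1"

definition scalar_elem :: "complex \<Rightarrow> 's free_alg" where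
  "scalar_elem c = Poly_Mapping.single 0 c"

definition free_ring :: "'s free_alg ring" where
  "free_ring = \<lparr>carrier = UNIV, monoid.mult = (*), one = 1, zero = 0, add = (+)\<rparr>"


section \<open>Chekhov-Fock algebras\<close>

text \<open>
  An ideal triangulation is recorded by the list of its triangles, each given by its sides in
  clockwise order.
\<close>

definition sigma :: "('s \<times> 's \<times> 's) list \<Rightarrow> 's \<Rightarrow> 's \<Rightarrow> int" where
  "sigma T x y =
    (\<Sum>(a, b, c)\<leftarrow>T. \<Sum>(u, w)\<leftarrow>[(a, b), (b, c), (c, a)].
      of_bool ((x, y) = (u, w)) - of_bool ((x, y) = (w, u)))"

definition cf_relations :: "complex \<Rightarrow> ('s \<times> 's \<times> 's) list \<Rightarrow> 's free_alg set" where
  "cf_relations q T =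
    (\<Union>s. {letter_elem (Pos s) * letter_elem (Neg s) - 1,
          letter_elem (Neg s) * letter_elem (Pos s) - 1}) \<union>
    (\<Union>a b. {letter_elem (Pos a) * letter_elem (Pos b)
            - scalar_elem (q powi (2 * sigma T a b)) * letter_elem (Pos b) * letter_elem (Pos a)})"

definition cf_ideal :: "complex \<Rightarrow> ('s \<times> 's \<times> 's) list \<Rightarrow> 's free_alg set" where
  "cf_ideal q T = genideal free_ring (cf_relations q T)"

definition cf_algebra :: "complex \<Rightarrow> ('s \<times> 's \<times> 's) list \<Rightarrow> 's free_alg set ring" where
  "cf_algebra q T = free_ring Quot cf_ideal q T"

definition cf_class :: "complex \<Rightarrow> ('s \<times> 's \<times> 's) list \<Rightarrow> 's free_alg \<Rightarrow> 's free_alg set" where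
  "cf_class q T p = cf_ideal q T +>\<^bsub>free_ring\<^esub> p"

definition cf_gen :: "complex \<Rightarrow> ('s \<times> 's \<times> 's) list \<Rightarrow> 's \<Rightarrow> 's free_alg set" where
  "cf_gen q T s = cf_class q T (letter_elem (Pos s))"

text \<open>
  Unital \<open>\<complex>\<close>-algebra homomorphisms to \<open>n \<times> n\<close> matrices. HOL-Algebra quotient rings carry no scalar
  multiplication; compatibility with the one of the algebra amounts to the condition on scalars.
\<close>

definition cf_hom ::
  "complex \<Rightarrow> ('s \<times> 's \<times> 's) list \<Rightarrow> nat \<Rightarrow> ('s free_alg set \<Rightarrow> complex mat) \<Rightarrow> bool" where
  "cf_hom q T n R \<longleftrightarrow>
    R \<in> Ring.ring_hom (cf_algebra q T) (ring_mat TYPE(complex) n ()) \<and>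
    (\<forall>c. R (cf_class q T (scalar_elem c)) = c \<cdot>\<^sub>m 1\<^sub>m n)"

text \<open>
  The algebra homomorphism sending each generator \<open>X\<^sub>s\<close> to \<open>A s\<close>. It is meaningful if the \<open>A s\<close> are
  invertible and satisfy the defining relations; the generators then determine it on the carrier,
  and extensionality fixes its values elsewhere.
\<close>

definition cf_lift ::
  "complex \<Rightarrow> ('s \<times> 's \<times> 's) list \<Rightarrow> nat \<Rightarrow> ('s \<Rightarrow> complex mat) \<Rightarrow> 's free_alg set \<Rightarrow> complex mat" where
  "cf_lift q T n A =
    (THE R. R \<in> extensional (carrier (cf_algebra q T)) \<and> cf_hom q T n R \<and>
            (\<forall>s. R (cf_gen q T s) = A s))"


section \<open>The two triangulations of the square\<close>

datatype side = Si | Sj | Sk | Sl | Sm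

definition square :: "(side \<times> side \<times> side) list" where
  "square = [(Sj, Si, Sm), (Si, Sk, Sl)]"

definition square' :: "(side \<times> side \<times> side) list" where
  "square' = [(Sj, Sk, Si), (Sm, Si, Sl)]"


section \<open>Operators on \<open>\<complex>\<^sup>N\<close> and \<open>\<complex>\<^sup>N \<otimes> \<complex>\<^sup>N\<close>\<close>

definition B1 :: "nat \<Rightarrow> complex \<Rightarrow> complex mat" where
  "B1 N q = mat N N (\<lambda>(r, k). if r = k then q ^ (2 * k) else 0)"

definition B2 :: "nat \<Rightarrow> complex mat" where
  "B2 N = mat N N (\<lambda>(r, k). if r = (k + 1) mod N then 1 else 0)"

text \<open>The row index \<open>k - 1\<close> modulo \<open>N\<close> is written \<open>k + N - 1\<close> because of truncated subtraction.\<close>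

definition B3 :: "nat \<Rightarrow> complex \<Rightarrow> complex mat" where
  "B3 N q = mat N N (\<lambda>(r, k). if r = (k + N - 1) mod N then q powi (1 - 2 * int k) else 0)"

text \<open>
  \<open>\<complex>\<^sup>m \<otimes> \<complex>\<^sup>n\<close> is modelled as \<open>\<complex>\<^sup>m\<^sup>n\<close>, with \<open>e\<^sub>b \<otimes> e\<^sub>c\<close> the basis vector of index \<open>b * n + c\<close> (Kronecker
  products).
\<close>

definition tensor_vec :: "complex vec \<Rightarrow> complex vec \<Rightarrow> complex vec" (infixl \<open>\<otimes>\<^sub>v\<close> 70) where
  "v \<otimes>\<^sub>v w = vec (dim_vec v * dim_vec w) (\<lambda>r. v $ (r div dim_vec w) * w $ (r mod dim_vec w))"

definition tensor_mat :: "complex mat \<Rightarrow> complex mat \<Rightarrow> complex mat" (infixl \<open>\<otimes>\<^sub>m\<close> 70) where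
  "A \<otimes>\<^sub>m B = mat (dim_row A * dim_row B) (dim_col A * dim_col B)
    (\<lambda>(r, c). A $$ (r div dim_row B, c div dim_col B) * B $$ (r mod dim_row B, c mod dim_col B))"

abbreviation End2 :: "nat \<Rightarrow> complex mat ring" where
  "End2 N \<equiv> ring_mat TYPE(complex) (N * N) ()"


section \<open>The coordinate change under the diagonal exchange\<close>

text \<open>
  The images of the generators of the Chekhov-Fock algebra of \<open>square'\<close> under \<open>\<rho> \<circ> \<Phi>\<close>: the operators
  \<open>\<rho> X\<^sub>s\<close> are substituted in the fractions defining the isomorphism \<open>\<Phi>\<close> of fraction rings.
\<close>

definition flip_ops ::
  "nat \<Rightarrow> complex \<Rightarrow> (side free_alg set \<Rightarrow> complex mat) \<Rightarrow> side \<Rightarrow> complex mat" where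
  "flip_ops N q \<rho> s =
    (let X = (\<lambda>s. \<rho> (cf_gen q square s));
         P = 1\<^sub>m (N * N) + q \<cdot>\<^sub>m X Si;
         Q = inv\<^bsub>End2 N\<^esub> (1\<^sub>m (N * N) + q \<cdot>\<^sub>m (inv\<^bsub>End2 N\<^esub> (X Si)))
     in case s of
          Si \<Rightarrow> inv\<^bsub>End2 N\<^esub> (X Si)
        | Sj \<Rightarrow> P * X Sj
        | Sk \<Rightarrow> Q * X Sk
        | Sl \<Rightarrow> P * X Sl
        | Sm \<Rightarrow> Q * X Sm)"

definition rho_Phi ::
  "nat \<Rightarrow> complex \<Rightarrow> (side free_alg set \<Rightarrow> complex mat) \<Rightarrow> side free_alg set \<Rightarrow> complex mat" where
  "rho_Phi N q \<rho> = cf_lift q square' (N * N) (flip_ops N q \<rho>)"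


section \<open>The coefficients of the intertwiner\<close>

definition f_coeff ::
  "complex \<Rightarrow> (side \<Rightarrow> complex) \<Rightarrow> (side \<Rightarrow> complex) \<Rightarrow> int \<Rightarrow> nat \<Rightarrow> complex" where
  "f_coeff q y v z a =
    (y Sj / v Sj) ^ a * (\<Prod>u = 1..a. 1 + y Si * q powi (1 - 2 * (int u + z)))"

definition p_poly ::
  "nat \<Rightarrow> (side \<Rightarrow> complex) \<Rightarrow> (side \<Rightarrow> complex) \<Rightarrow> complex \<Rightarrow> complex" where
  "p_poly N y v x = (\<Sum>d<N. (y Sl * y Sk * y Si / (v Sl * v Sk)) ^ d * x ^ d)"

definition L_coeff ::
  "nat \<Rightarrow> complex \<Rightarrow> (side \<Rightarrow> complex) \<Rightarrow> (side \<Rightarrow> complex) \<Rightarrow> int \<Rightarrow> nat \<Rightarrow> nat \<Rightarrow> nat \<Rightarrow> nat \<Rightarrow> complex"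
  where
  "L_coeff N q y v z s t b c =
    q powi (- (int s)\<^sup>2 + 2 * z * (int b - int c - z) + 2 * int b * int c)
    * (y Sj * y Sk * y Si / (v Sj * v Sk)) powi (int c + z)
    * p_poly N y v (q powi (2 * (int s + int t - int c - z)))
    * (\<Sum>a<N. q powi (2 * int a * (int b - int s)) * f_coeff q y v z a)"

end

(* Write w for q^2. An isomorphism L intertwines rho' with rho o Phi iff, after the denominators
   1 + q X_i^(-1) are cleared by a multiplication with X_i, it satisfies five polynomial identities,
   one for each generator. The matrix of L has the form
   (phase quadratic in s, b, c) * mu^(c+z) * P(s+t-c-z) * G(b-s), where P and G are discrete Fourier
   transforms of r^d and f. The geometric sequence r^d, with r^N = 1, gives P(n) (r w^n - 1) = 0,
   while the first order recursion for f, which is N-periodic because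
   prod_u (1 + y_i q^(1-2(u+z))) = 1 + x_i, gives
   G(n) + y_i q^(-1-2z) G(n-1) = (v_j/y_j) w^(-n) G(n). The five identities follow from these two.
   Fourier inversion gives the inverse of L, and conjugation of rho' by L then produces rho o Phi
   without constructing homomorphisms out of the Chekhov-Fock algebra. Uniqueness is Schur's lemma:
   a matrix commuting with X'_j and X'_m is diagonal, and one that also commutes with X'_k and X'_l
   is constant on the diagonal. *)

theory Submission
  imports Defs "Jordan_Normal_Form.Determinant"
begin

section \<open>Representations of Chekhov-Fock algebras\<close>

lemma free_ring_simps [simp]:
  "carrier free_ring = UNIV" "monoid.mult free_ring = (*)" "one free_ring = 1"
  "zero free_ring = 0" "add free_ring = (+)"
  by (simp_all add: free_ring_def)

lemma ring_free_ring: "ring (free_ring :: 's free_alg ring)"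
proof (rule ringI)
  show "abelian_group (free_ring :: 's free_alg ring)"
  proof (rule abelian_groupI)
    fix p :: "'s free_alg"
    show "\<exists>y\<in>carrier free_ring. y \<oplus>\<^bsub>free_ring\<^esub> p = \<zero>\<^bsub>free_ring\<^esub>"
      by (rule bexI[of _ "- p"]) simp_all
  qed (simp_all add: algebra_simps)
  show "Group.monoid (free_ring :: 's free_alg ring)"
    by unfold_locales (simp_all add: algebra_simps)
qed (simp_all add: algebra_simps)

lemma ideal_cf_ideal: "ideal (cf_ideal q T) (free_ring :: 's free_alg ring)"
  unfolding cf_ideal_def by (rule ring.genideal_ideal[OF ring_free_ring]) simp

lemma cf_class_ring_hom: "cf_class q T \<in> Ring.ring_hom free_ring (cf_algebra q T)"
proof -
  have "cf_class q T = (+>\<^bsub>free_ring\<^esub>) (cf_ideal q T)"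
    by (rule ext) (simp add: cf_class_def)
  then show ?thesis
    using ideal.rcos_ring_hom[OF ideal_cf_ideal, of q T] by (simp add: cf_algebra_def)
qed

lemma cf_class_closed [simp]: "cf_class q T p \<in> carrier (cf_algebra q T)"
  using ring_hom_closed[OF cf_class_ring_hom] by simp

lemma ring_cf_algebra: "ring (cf_algebra q T)"
  unfolding cf_algebra_def by (rule ideal.quotient_is_ring[OF ideal_cf_ideal])

lemma carrier_cf_algebra: "carrier (cf_algebra q T) = range (cf_class q T)"
  by (auto simp: cf_algebra_def cf_class_def FactRing_def A_RCOSETS_def'[of free_ring] image_def)

lemma cf_class_eq_zero:
  assumes "p \<in> cf_relations q T"
  shows "cf_class q T p = \<zero>\<^bsub>cf_algebra q T\<^esub>"
proof -
  have "p \<in> cf_ideal q T"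
    unfolding cf_ideal_def
    using ring.genideal_self[OF ring_free_ring, of "cf_relations q T"] assms by auto
  then show ?thesis
    using ring.a_rcos_zero[OF ring_free_ring ideal_cf_ideal] by (simp add: cf_class_def cf_algebra_def FactRing_def)
qed

lemma cf_class_mult:
  "cf_class q T (a * b) = cf_class q T a \<otimes>\<^bsub>cf_algebra q T\<^esub> cf_class q T b"
  using ring_hom_mult[OF cf_class_ring_hom, of a b] by simp

lemma cf_class_add:
  "cf_class q T (a + b) = cf_class q T a \<oplus>\<^bsub>cf_algebra q T\<^esub> cf_class q T b"
  using ring_hom_add[OF cf_class_ring_hom, of a b] by simp

text \<open>The defining relations are recorded as differences; writing \<open>a\<close> as
  \<open>(a - b) + b\<close> turns each of them into an equation between classes.\<close>

lemma cf_class_eqI: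
  assumes "a - b \<in> cf_relations q T"
  shows "cf_class q T a = cf_class q T b"
proof -
  interpret ring "cf_algebra q T" by (rule ring_cf_algebra)
  have "cf_class q T ((a - b) + b) = cf_class q T b"
    unfolding cf_class_add cf_class_eq_zero[OF assms] by simp
  then show ?thesis by simp
qed

lemma cf_class_Neg_Pos: "cf_class q T (letter_elem (Neg s) * letter_elem (Pos s)) = cf_class q T 1"
  by (rule cf_class_eqI) (auto simp: cf_relations_def)

lemma cf_class_Pos_Neg: "cf_class q T (letter_elem (Pos s) * letter_elem (Neg s)) = cf_class q T 1"
  by (rule cf_class_eqI) (auto simp: cf_relations_def)

section \<open>Homomorphisms to matrix rings and their uniqueness\<close>

lemma one_smult_mat: "(1 :: 'a :: comm_ring_1) \<cdot>\<^sub>m A = A"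
  by (rule eq_matI) auto

context
  fixes q :: complex and T :: "('s \<times> 's \<times> 's) list" and n :: nat
    and R :: "'s free_alg set \<Rightarrow> complex mat"
  assumes R: "cf_hom q T n R"
begin

lemma cf_hom_ring_hom: "R \<in> Ring.ring_hom (cf_algebra q T) (ring_mat TYPE(complex) n ())"
  using R by (simp add: cf_hom_def)

lemma cf_hom_carrier: "R (cf_class q T a) \<in> carrier_mat n n"
  using ring_hom_closed[OF cf_hom_ring_hom cf_class_closed] by (simp add: ring_mat_simps)

lemma cf_hom_mult: "R (cf_class q T (a * b)) = R (cf_class q T a) * R (cf_class q T b)"
  using ring_hom_mult[OF cf_hom_ring_hom cf_class_closed cf_class_closed, of a b]
  by (simp add: cf_class_mult ring_mat_simps)

lemma cf_hom_add: "R (cf_class q T (a + b)) = R (cf_class q T a) + R (cf_class q T b)"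
  using ring_hom_add[OF cf_hom_ring_hom cf_class_closed cf_class_closed, of a b]
  by (simp add: cf_class_add ring_mat_simps)

lemma cf_hom_scalar: "R (cf_class q T (scalar_elem c)) = c \<cdot>\<^sub>m 1\<^sub>m n"
  using R by (simp add: cf_hom_def)

lemma cf_hom_one: "R (cf_class q T 1) = 1\<^sub>m n"
  using cf_hom_scalar[of 1] by (simp add: scalar_elem_def one_smult_mat)

lemma cf_hom_Neg_Pos:
  "R (cf_class q T (letter_elem (Neg s))) * R (cf_gen q T s) = 1\<^sub>m n"
  by (simp add: cf_gen_def cf_class_Neg_Pos cf_hom_one flip: cf_hom_mult)

lemma cf_hom_Pos_Neg:
  "R (cf_gen q T s) * R (cf_class q T (letter_elem (Neg s))) = 1\<^sub>m n"
  by (simp add: cf_gen_def cf_class_Pos_Neg cf_hom_one flip: cf_hom_mult)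

end

lemma single_Word_Cons:
  "Poly_Mapping.single (Word (a # w)) (c :: complex) = letter_elem a * Poly_Mapping.single (Word w) c"
  by (simp add: letter_elem_def mult_single plus_word_def)

text \<open>Agreement passes from the generators to the inverse letters because matrix inverses are
  unique, then to words by multiplicativity and to all classes by additivity.\<close>

lemma cf_hom_unique:
  fixes T :: "('s \<times> 's \<times> 's) list"
  assumes R: "cf_hom q T n R" and R': "cf_hom q T n R'"
    and gen: "\<And>s. R (cf_gen q T s) = R' (cf_gen q T s)"
    and X: "X \<in> carrier (cf_algebra q T)"
  shows "R X = R' X"
proof -
  have letter: "R (cf_class q T (letter_elem a)) = R' (cf_class q T (letter_elem a))" for a
  proof (cases a)
    case (Pos s)
    then show ?thesis using gen by (simp add: cf_gen_def)
  next
    case (Neg s)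
    define A B B' where "A = R (cf_gen q T s)" and "B = R (cf_class q T (letter_elem a))"
      and "B' = R' (cf_class q T (letter_elem a))"
    have carr: "A \<in> carrier_mat n n" "B \<in> carrier_mat n n" "B' \<in> carrier_mat n n"
      unfolding A_def B_def B'_def cf_gen_def
      using cf_hom_carrier[OF R] cf_hom_carrier[OF R'] by blast+
    \<comment> \<open>Through \<open>R\<close>, \<open>B\<close> is a left inverse of
      \<open>A\<close>; through \<open>R'\<close>, \<open>B'\<close> is a right inverse of the same
      \<open>A\<close>.\<close>
    have inv: "B * A = 1\<^sub>m n" "A * B' = 1\<^sub>m n"
      unfolding A_def B_def B'_def Neg
      using cf_hom_Neg_Pos[OF R, of s] cf_hom_Pos_Neg[OF R', of s] gen by auto
    have "B = B * (A * B')"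
      using carr inv by simp
    also have "\<dots> = (B * A) * B'"
      using carr by (simp add: assoc_mult_mat[of B n n A n B' n])
    also have "\<dots> = B'"
      using carr inv by simp
    finally show ?thesis by (simp add: B_def B'_def)
  qed
  \<comment> \<open>The coefficient \<open>c\<close> stays with the remaining word down to the empty
    one, where compatibility with scalars settles it.\<close>
  have word: "R (cf_class q T (Poly_Mapping.single (Word w) c)) = R' (cf_class q T (Poly_Mapping.single (Word w) c))"
    for w c
  proof (induction w)
    case Nil
    have "Poly_Mapping.single (Word []) c = (scalar_elem c :: 's free_alg)"
      by (simp add: scalar_elem_def zero_word_def)
    then show ?case by (simp only: cf_hom_scalar[OF R] cf_hom_scalar[OF R'])
  next
    case (Cons a w)
    then show ?case
      by (simp add: single_Word_Cons cf_hom_mult[OF R] cf_hom_mult[OF R'] letter)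
  qed
  have "R (cf_class q T p) = R' (cf_class q T p)" for p
  proof (induction p rule: update_induct)
    case const
    show ?case
      using cf_hom_scalar[OF R, of 0] cf_hom_scalar[OF R', of 0] by (simp add: scalar_elem_def)
  next
    case (update f u c)
    \<comment> \<open>The key \<open>u\<close> is fresh for \<open>f\<close>, so updating at
      \<open>u\<close> amounts to adding a monomial.\<close>
    have "Poly_Mapping.update u c f = f + Poly_Mapping.single u c"
      using update(1) by (intro poly_mapping_eqI)
        (auto simp: lookup_update lookup_add lookup_single when_def in_keys_iff)
    moreover obtain w where "u = Word w" by (cases u)
    ultimately show ?case
      using update(3) word by (simp add: cf_hom_add[OF R] cf_hom_add[OF R'])
  qed
  with X show ?thesis by (auto simp: carrier_cf_algebra)
qed

text \<open>Conjugating a known representation gives another one without checking any defining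
  relation. Restricting to the carrier makes it the extensional function that \<open>cf_lift\<close>
  asks for.\<close>

lemma cf_hom_conj:
  assumes R: "cf_hom q T n R" and M: "M \<in> carrier_mat n n" and M': "M' \<in> carrier_mat n n"
    and MM': "M * M' = 1\<^sub>m n" and M'M: "M' * M = 1\<^sub>m n"
  shows "cf_hom q T n (\<lambda>X\<in>carrier (cf_algebra q T). M * R X * M')"
proof -
  have RC: "R X \<in> carrier_mat n n" if "X \<in> carrier (cf_algebra q T)" for X
    using that cf_hom_carrier[OF R] by (auto simp: carrier_cf_algebra)
  interpret A: ring "cf_algebra q T" by (rule ring_cf_algebra)
  have rh: "R \<in> Ring.ring_hom (cf_algebra q T) (ring_mat TYPE(complex) n ())"
    using R by (simp add: cf_hom_def)
  have conj_mult: "M * (A * B) * M' = (M * A * M') * (M * B * M')"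
    if A: "A \<in> carrier_mat n n" and B: "B \<in> carrier_mat n n" for A B
  proof -
    have "(M * A * M') * (M * B * M') = M * A * (M' * M) * B * M'"
      using M M' A B by (simp add: assoc_mult_mat[of _ n n _ n _ n])
    also have "\<dots> = M * (A * B) * M'"
      using M M' A B by (simp add: M'M assoc_mult_mat[of _ n n _ n _ n])
    finally show ?thesis by simp
  qed
  have conj_add: "M * (A + B) * M' = M * A * M' + M * B * M'"
    if A: "A \<in> carrier_mat n n" and B: "B \<in> carrier_mat n n" for A B
    using M M' A B
    by (simp add: mult_add_distrib_mat[of _ n n _ n] add_mult_distrib_mat[of _ n n _ _ n])
  have conj_scalar: "M * (c \<cdot>\<^sub>m 1\<^sub>m n) * M' = c \<cdot>\<^sub>m 1\<^sub>m n" for c :: complex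
    using M M' by (simp add: mult_smult_distrib[of _ n n _ n] mult_smult_assoc_mat[of _ n n _ n] MM')
  have "(\<lambda>X\<in>carrier (cf_algebra q T). M * R X * M')
      \<in> Ring.ring_hom (cf_algebra q T) (ring_mat TYPE(complex) n ())"
  proof (rule ring_hom_memI)
    fix X Y assume X: "X \<in> carrier (cf_algebra q T)" and Y: "Y \<in> carrier (cf_algebra q T)"
    show "(\<lambda>X\<in>carrier (cf_algebra q T). M * R X * M') X \<in> carrier (ring_mat TYPE(complex) n ())"
      using X M M' RC[OF X] by (simp add: ring_mat_simps mult_carrier_mat[of _ n n _ n])
    show "(\<lambda>X\<in>carrier (cf_algebra q T). M * R X * M') (X \<otimes>\<^bsub>cf_algebra q T\<^esub> Y) =
      (\<lambda>X\<in>carrier (cf_algebra q T). M * R X * M') X \<otimes>\<^bsub>ring_mat TYPE(complex) n ()\<^esub>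
      (\<lambda>X\<in>carrier (cf_algebra q T). M * R X * M') Y"
      using X Y ring_hom_mult[OF rh X Y] conj_mult[OF RC[OF X] RC[OF Y]]
      by (simp add: ring_mat_simps)
    show "(\<lambda>X\<in>carrier (cf_algebra q T). M * R X * M') (X \<oplus>\<^bsub>cf_algebra q T\<^esub> Y) =
      (\<lambda>X\<in>carrier (cf_algebra q T). M * R X * M') X \<oplus>\<^bsub>ring_mat TYPE(complex) n ()\<^esub>
      (\<lambda>X\<in>carrier (cf_algebra q T). M * R X * M') Y"
      using X Y ring_hom_add[OF rh X Y] conj_add[OF RC[OF X] RC[OF Y]]
      by (simp add: ring_mat_simps)
  next
    show "(\<lambda>X\<in>carrier (cf_algebra q T). M * R X * M') \<one>\<^bsub>cf_algebra q T\<^esub> = \<one>\<^bsub>ring_mat TYPE(complex) n ()\<^esub>"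
      using conj_scalar[of 1] ring_hom_one[OF rh] by (simp add: ring_mat_simps one_smult_mat)
  qed
  then show ?thesis
    using cf_hom_scalar[OF R] conj_scalar by (simp add: cf_hom_def)
qed

text \<open>Turns the definite description into a check of three properties:
  \<open>cf_hom_unique\<close> gives uniqueness on the carrier, extensionality gives it
  elsewhere.\<close>

lemma cf_lift_eq:
  assumes "R \<in> extensional (carrier (cf_algebra q T))" and "cf_hom q T n R"
    and "\<And>s. R (cf_gen q T s) = A s"
  shows "cf_lift q T n A = R"
  unfolding cf_lift_def
proof (rule the_equality)
  fix R' assume R': "R' \<in> extensional (carrier (cf_algebra q T)) \<and> cf_hom q T n R' \<and>
    (\<forall>s. R' (cf_gen q T s) = A s)"
  show "R' = R"
  proof (rule extensionalityI[of _ "carrier (cf_algebra q T)"])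
    fix X assume X: "X \<in> carrier (cf_algebra q T)"
    show "R' X = R X"
      by (rule cf_hom_unique[OF _ assms(2) _ X, of R']) (use R' assms(3) in auto)
  qed (use R' assms in auto)
qed (use assms in auto)

section \<open>Operators with kernels on the discrete torus\<close>

text \<open>Indices are integers instead of residues, so that shifts need no reduction modulo
  \<open>N\<close>; this predicate says that a kernel descends to the discrete torus.\<close>

definition per2 :: "nat \<Rightarrow> (int \<Rightarrow> int \<Rightarrow> complex) \<Rightarrow> bool" where
  "per2 N h \<longleftrightarrow> (\<forall>u w. h (u + int N) w = h u w \<and> h u (w + int N) = h u w)"

lemma periodic_cong:
  fixes f :: "int \<Rightarrow> 'a"
  assumes per: "\<And>n. f (n + int N) = f n" and dvd: "int N dvd m - n"
  shows "f m = f n"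
proof -
  have shift: "f (n + int N * int k) = f n" for n k
  proof (induction k)
    case (Suc k)
    then show ?case using per[of "n + int N * int k"] by (simp add: algebra_simps)
  qed simp
  obtain k where k: "m - n = int N * k" using dvd by (rule dvdE)
  show ?thesis
  proof (cases "k \<ge> 0")
    case True
    then show ?thesis using shift[of n "nat k"] k by (simp add: algebra_simps)
  next
    \<comment> \<open>For negative \<open>k\<close>, the point \<open>n\<close> is reached from
      \<open>m\<close> by a positive multiple of \<open>N\<close>.\<close>
    case False
    then show ?thesis using shift[of m "nat (- k)"] k by (simp add: algebra_simps)
  qed
qed

lemma per2_cong:
  assumes "per2 N h" "int N dvd m - m'" "int N dvd n - n'"
  shows "h m n = h m' n'"
proof -
  have "h m n = h m' n"
    by (rule periodic_cong[of "\<lambda>u. h u n"]) (use assms in \<open>auto simp: per2_def\<close>)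
  also have "\<dots> = h m' n'"
    by (rule periodic_cong) (use assms in \<open>auto simp: per2_def\<close>)
  finally show ?thesis .
qed

text \<open>The range \<open>{0..<N}\<close> contains exactly one representative of each residue
  class.\<close>

lemma dvd_diff_iff_eq_mod:
  assumes "u < N"
  shows "int N dvd int u - n \<longleftrightarrow> u = nat (n mod int N)"
proof -
  have "int N dvd int u - n \<longleftrightarrow> int u mod int N = n mod int N"
    by (simp add: mod_eq_dvd_iff)
  then show ?thesis using assms by auto
qed

lemma sum_dvd_delta:
  assumes "N > 0"
  shows "(\<Sum>u<N. if int N dvd int u - n then h u else 0) = (h (nat (n mod int N)) :: complex)"
proof -
  have "(\<Sum>u<N. if int N dvd int u - n then h u else 0) =
      (\<Sum>u<N. if u = nat (n mod int N) then h u else 0)"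
    by (rule sum.cong) (auto simp: dvd_diff_iff_eq_mod)
  also have "\<dots> = h (nat (n mod int N))"
    using assms by (simp add: nat_less_iff)
  finally show ?thesis .
qed

text \<open>The one surviving summand sits at the representatives of \<open>m\<close> and
  \<open>n\<close> below \<open>N\<close>; periodicity replaces them by \<open>m\<close> and
  \<open>n\<close> themselves.\<close>

lemma sum_dvd_delta2:
  assumes N: "N > 0" and h: "per2 N h"
  shows "(\<Sum>u<N. \<Sum>w<N. if int N dvd int u - m \<and> int N dvd int w - n then h (int u) (int w) else 0) = h m n"
proof -
  have "(\<Sum>u<N. \<Sum>w<N. if int N dvd int u - m \<and> int N dvd int w - n then h (int u) (int w) else 0) =
      (\<Sum>u<N. if int N dvd int u - m then
        (\<Sum>w<N. if int N dvd int w - n then h (int u) (int w) else 0) else 0)"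
    by (intro sum.cong) auto
  also have "\<dots> = h (m mod int N) (n mod int N)"
    using N by (simp add: sum_dvd_delta)
  also have "\<dots> = h m n"
    by (rule per2_cong[OF h]) (simp_all flip: mod_eq_dvd_iff)
  finally show ?thesis .
qed

lemma mult_add_less_square:
  fixes s t N :: nat
  assumes "s < N" "t < N"
  shows "s * N + t < N * N"
proof -
  have "s * N + t < Suc s * N" using assms by simp
  also have "\<dots> \<le> N * N" using assms by (intro mult_le_mono1) simp
  finally show ?thesis .
qed

text \<open>Division with remainder splits the flat index of a Kronecker basis vector, which turns
  the sum in a matrix product into a double sum.\<close>

lemma sum_div_mod:
  fixes h :: "nat \<Rightarrow> nat \<Rightarrow> complex"
  assumes "N > 0"
  shows "(\<Sum>i<N * N. h (i div N) (i mod N)) = (\<Sum>u<N. \<Sum>w<N. h u w)"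
proof -
  have "(\<Sum>i<N * N. h (i div N) (i mod N)) = (\<Sum>(u, w)\<in>{..<N} \<times> {..<N}. h u w)"
    by (rule sum.reindex_bij_witness[of _ "\<lambda>(u, w). u * N + w" "\<lambda>i. (i div N, i mod N)"])
      (use assms in \<open>auto simp: less_mult_imp_div_less mult_add_less_square\<close>)
  then show ?thesis by (simp add: sum.cartesian_product)
qed

text \<open>The operator whose column \<open>(s, t)\<close> has the entry \<open>F s t b c\<close> in row \<open>(b, c)\<close>.\<close>

definition kmat :: "nat \<Rightarrow> (int \<Rightarrow> int \<Rightarrow> int \<Rightarrow> int \<Rightarrow> complex) \<Rightarrow> complex mat" where
  "kmat N F = mat (N * N) (N * N)
    (\<lambda>(r, k). F (int (k div N)) (int (k mod N)) (int (r div N)) (int (r mod N)))"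

definition kdelta :: "nat \<Rightarrow> int \<Rightarrow> int \<Rightarrow> complex" where
  "kdelta N m n = of_bool (int N dvd m - n)"

text \<open>The operator \<open>e\<^sub>s \<otimes> e\<^sub>t \<mapsto> g s t e\<^bsub>s+i\<^esub> \<otimes> e\<^bsub>t+j\<^esub>\<close>, with indices modulo \<open>N\<close>.\<close>

definition wshift :: "nat \<Rightarrow> (int \<Rightarrow> int \<Rightarrow> complex) \<Rightarrow> int \<Rightarrow> int \<Rightarrow> complex mat" where
  "wshift N g i j = kmat N
    (\<lambda>s t b c. if int N dvd b - (s + i) \<and> int N dvd c - (t + j) then g s t else 0)"

lemma kmat_carrier [simp]: "kmat N F \<in> carrier_mat (N * N) (N * N)"
  by (simp add: kmat_def)

lemma wshift_carrier [simp]: "wshift N g i j \<in> carrier_mat (N * N) (N * N)"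
  by (simp add: wshift_def)

lemma kmat_dim [simp]: "dim_row (kmat N F) = N * N" "dim_col (kmat N F) = N * N"
  by (simp_all add: kmat_def)

lemma kmat_cong:
  assumes "\<And>s t b c. s \<in> {0..<int N} \<Longrightarrow> t \<in> {0..<int N} \<Longrightarrow> b \<in> {0..<int N} \<Longrightarrow> c \<in> {0..<int N} \<Longrightarrow>
    F s t b c = G s t b c"
  shows "kmat N F = kmat N G"
proof (cases "N = 0")
  case False
  then show ?thesis
    unfolding kmat_def by (intro eq_matI) (auto intro!: assms simp: less_mult_imp_div_less)
qed (auto simp: kmat_def)

lemma kmat_add: "kmat N F + kmat N G = kmat N (\<lambda>s t b c. F s t b c + G s t b c)"
  by (auto simp: kmat_def intro!: eq_matI)

lemma kmat_smult: "a \<cdot>\<^sub>m kmat N F = kmat N (\<lambda>s t b c. a * F s t b c)"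
  by (auto simp: kmat_def intro!: eq_matI)

lemma kmat_mult:
  "kmat N F * kmat N G = kmat N (\<lambda>s t b c. \<Sum>u<N. \<Sum>w<N. F (int u) (int w) b c * G s t (int u) (int w))"
proof (cases "N = 0")
  case False
  then have N: "N > 0" by simp
  show ?thesis
  proof (rule eq_matI)
    fix r k
    assume "r < dim_row (kmat N (\<lambda>s t b c. \<Sum>u<N. \<Sum>w<N. F (int u) (int w) b c * G s t (int u) (int w)))"
      and "k < dim_col (kmat N (\<lambda>s t b c. \<Sum>u<N. \<Sum>w<N. F (int u) (int w) b c * G s t (int u) (int w)))"
    then have rk: "r < N * N" "k < N * N" by simp_all
    let ?h = "\<lambda>u w. F (int u) (int w) (int (r div N)) (int (r mod N)) *
      G (int (k div N)) (int (k mod N)) (int u) (int w)"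
    have "(kmat N F * kmat N G) $$ (r, k) = (\<Sum>i<N * N. ?h (i div N) (i mod N))"
      using rk by (simp add: kmat_def scalar_prod_def lessThan_atLeast0)
    also have "\<dots> = (\<Sum>u<N. \<Sum>w<N. ?h u w)"
      by (rule sum_div_mod[OF N])
    finally show "(kmat N F * kmat N G) $$ (r, k) =
      kmat N (\<lambda>s t b c. \<Sum>u<N. \<Sum>w<N. F (int u) (int w) b c * G s t (int u) (int w)) $$ (r, k)"
      using rk by (simp add: kmat_def)
  qed simp_all
qed (auto simp: kmat_def intro!: eq_matI)

lemma one_mat_eq_kmat: "1\<^sub>m (N * N) = kmat N (\<lambda>s t b c. kdelta N s b * kdelta N t c)"
proof (rule eq_matI)
  fix r k
  assume "r < dim_row (kmat N (\<lambda>s t b c. kdelta N s b * kdelta N t c))"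
    and "k < dim_col (kmat N (\<lambda>s t b c. kdelta N s b * kdelta N t c))"
  then have rk: "r < N * N" "k < N * N" by simp_all
  then have N: "N > 0" by (cases N) auto
  have "kmat N (\<lambda>s t b c. kdelta N s b * kdelta N t c) $$ (r, k) =
      of_bool (k div N = r div N \<and> k mod N = r mod N)"
    using rk N by (auto simp: kmat_def kdelta_def dvd_diff_iff_eq_mod less_mult_imp_div_less)
  moreover have "k div N = r div N \<and> k mod N = r mod N \<longleftrightarrow> r = k"
    by (metis div_mult_mod_eq)
  ultimately show "1\<^sub>m (N * N) $$ (r, k) = kmat N (\<lambda>s t b c. kdelta N s b * kdelta N t c) $$ (r, k)"
    using rk by simp
qed simp_all

text \<open>A column of a weighted shift has at most one nonzero entry, so the product only moves
  and weights the column indices of \<open>F\<close>. Periodicity in these makes the unreduced index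
  \<open>s + i\<close> legitimate.\<close>

lemma kmat_mult_wshift:
  assumes N: "N > 0" and F: "\<And>b c. per2 N (\<lambda>s t. F s t b c)"
  shows "kmat N F * wshift N g i j = kmat N (\<lambda>s t b c. g s t * F (s + i) (t + j) b c)"
  unfolding wshift_def kmat_mult
proof (rule kmat_cong)
  fix s t b c
  have "(\<Sum>u<N. \<Sum>w<N. F (int u) (int w) b c *
      (if int N dvd int u - (s + i) \<and> int N dvd int w - (t + j) then g s t else 0)) =
    (\<Sum>u<N. \<Sum>w<N. if int N dvd int u - (s + i) \<and> int N dvd int w - (t + j)
      then g s t * F (int u) (int w) b c else 0)"
    by (intro sum.cong refl) simp
  also have "\<dots> = g s t * F (s + i) (t + j) b c"
    by (rule sum_dvd_delta2[OF N]) (use F in \<open>simp add: per2_def\<close>)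
  finally show "(\<Sum>u<N. \<Sum>w<N. F (int u) (int w) b c *
      (if int N dvd int u - (s + i) \<and> int N dvd int w - (t + j) then g s t else 0)) =
    g s t * F (s + i) (t + j) b c" .
qed

text \<open>The shift now acts on rows, and weight and kernel are both read at the source
  \<open>(b - i, c - j)\<close> of the target \<open>(b, c)\<close>; hence \<open>g\<close> has to
  be periodic as well.\<close>

lemma wshift_mult_kmat:
  assumes N: "N > 0" and g: "per2 N g" and F: "\<And>s t. per2 N (F s t)"
  shows "wshift N g i j * kmat N F = kmat N (\<lambda>s t b c. g (b - i) (c - j) * F s t (b - i) (c - j))"
  unfolding wshift_def kmat_mult
proof (rule kmat_cong)
  fix s t b c
  have flip: "int N dvd b - (u + i) \<longleftrightarrow> int N dvd u - (b - i)" for u b i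
    using dvd_minus_iff[of "int N" "b - (u + i)"] by (simp add: algebra_simps)
  have "(\<Sum>u<N. \<Sum>w<N. (if int N dvd b - (int u + i) \<and> int N dvd c - (int w + j)
      then g (int u) (int w) else 0) * F s t (int u) (int w)) =
    (\<Sum>u<N. \<Sum>w<N. if int N dvd int u - (b - i) \<and> int N dvd int w - (c - j)
      then g (int u) (int w) * F s t (int u) (int w) else 0)"
    by (intro sum.cong refl) (simp add: flip)
  also have "\<dots> = g (b - i) (c - j) * F s t (b - i) (c - j)"
    by (rule sum_dvd_delta2[OF N]) (use F g in \<open>simp add: per2_def\<close>)
  finally show "(\<Sum>u<N. \<Sum>w<N. (if int N dvd b - (int u + i) \<and> int N dvd c - (int w + j)
      then g (int u) (int w) else 0) * F s t (int u) (int w)) = g (b - i) (c - j) * F s t (b - i) (c - j)" .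
qed

text \<open>One tensor factor of a weighted shift, a common form for \<open>B1\<close>,
  \<open>B2\<close>, \<open>B3\<close> and the identity.\<close>

definition monomial_mat :: "nat \<Rightarrow> (int \<Rightarrow> complex) \<Rightarrow> int \<Rightarrow> complex mat" where
  "monomial_mat N g i = mat N N (\<lambda>(r, k). if int N dvd int r - (int k + i) then g (int k) else 0)"

lemma B1_eq_monomial_mat: "B1 N q = monomial_mat N (\<lambda>k. q powi (2 * k)) 0"
  by (rule eq_matI)
    (auto simp: B1_def monomial_mat_def dvd_diff_iff_eq_mod power_int_def nat_mult_distrib)

lemma B2_eq_monomial_mat: "B2 N = monomial_mat N (\<lambda>k. 1) 1"
proof (rule eq_matI)
  fix r k assume rk: "r < dim_row (monomial_mat N (\<lambda>k. 1) 1)" "k < dim_col (monomial_mat N (\<lambda>k. 1) 1)"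
  have "nat ((int k + 1) mod int N) = (k + 1) mod N"
    by (metis nat_int of_nat_1 of_nat_add zmod_int)
  then show "B2 N $$ (r, k) = monomial_mat N (\<lambda>k. 1) 1 $$ (r, k)"
    using rk by (simp add: B2_def monomial_mat_def dvd_diff_iff_eq_mod)
qed (simp_all add: B2_def monomial_mat_def)

lemma B3_eq_monomial_mat: "B3 N q = monomial_mat N (\<lambda>k. q powi (1 - 2 * k)) (-1)"
proof (rule eq_matI)
  fix r k assume rk: "r < dim_row (monomial_mat N (\<lambda>k. q powi (1 - 2 * k)) (-1))"
    "k < dim_col (monomial_mat N (\<lambda>k. q powi (1 - 2 * k)) (-1))"
  \<comment> \<open>The column index \<open>k < N\<close> forces \<open>N > 0\<close>, so
    \<open>k + N - 1\<close> is not truncated and is congruent to \<open>k - 1\<close>.\<close>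
  have "(int k + (- 1)) mod int N = int (k + N - 1) mod int N"
    using rk by (auto simp: monomial_mat_def mod_eq_dvd_iff)
  then have "nat ((int k + (- 1)) mod int N) = (k + N - 1) mod N"
    by (metis nat_int zmod_int)
  then show "B3 N q $$ (r, k) = monomial_mat N (\<lambda>k. q powi (1 - 2 * k)) (-1) $$ (r, k)"
    using rk by (simp only: B3_def monomial_mat_def dim_row_mat dim_col_mat index_mat prod.case
        dvd_diff_iff_eq_mod)
qed (simp_all add: B3_def monomial_mat_def)

lemma one_mat_eq_monomial_mat: "1\<^sub>m N = monomial_mat N (\<lambda>k. 1) 0"
  by (rule eq_matI) (auto simp: monomial_mat_def dvd_diff_iff_eq_mod)

lemma smult_tensor_monomial_mat:
  "a \<cdot>\<^sub>m (monomial_mat N g i \<otimes>\<^sub>m monomial_mat N h j) = wshift N (\<lambda>s t. a * (g s * h t)) i j"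
proof (cases "N = 0")
  case False
  then show ?thesis
    by (intro eq_matI)
      (auto simp: tensor_mat_def monomial_mat_def wshift_def kmat_def less_mult_imp_div_less)
qed (auto simp: tensor_mat_def monomial_mat_def wshift_def kmat_def intro!: eq_matI)

section \<open>Basis tensors and columns of operators\<close>

lemma tensor_unit_vec:
  assumes "s < N" "t < N"
  shows "unit_vec N s \<otimes>\<^sub>v unit_vec N t = unit_vec (N * N) (s * N + t)"
proof (rule eq_vecI)
  fix i assume i: "i < dim_vec (unit_vec (N * N) (s * N + t))"
  then have "i < N * N" by simp
  then have "i div N < N" "i mod N < N" using assms by (auto simp: less_mult_imp_div_less)
  moreover have "i = s * N + t \<longleftrightarrow> i div N = s \<and> i mod N = t"
    using assms by auto
  ultimately show "(unit_vec N s \<otimes>\<^sub>v unit_vec N t) $ i = unit_vec (N * N) (s * N + t) $ i"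
    using assms \<open>i < N * N\<close>
    by (auto simp: tensor_vec_def unit_vec_def)
qed (simp add: tensor_vec_def)

lemma finsum_tensor_unit_vec:
  "finsum_vec TYPE(complex) (N * N) (\<lambda>(b, c). h b c \<cdot>\<^sub>v (unit_vec N b \<otimes>\<^sub>v unit_vec N c))
      ({..<N} \<times> {..<N}) = vec (N * N) (\<lambda>r. h (r div N) (r mod N))" (is "?l = ?r")
proof (rule eq_vecI)
  have vs: "(\<lambda>(b, c). h b c \<cdot>\<^sub>v (unit_vec N b \<otimes>\<^sub>v unit_vec N c)) \<in> {..<N} \<times> {..<N} \<rightarrow> carrier_vec (N * N)"
    by (auto simp: tensor_unit_vec)
  have "?l \<in> carrier_vec (N * N)"
    by (rule finsum_vec_closed[OF vs])
  then show "dim_vec ?l = dim_vec ?r" by simp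
  fix r assume "r < dim_vec ?r"
  then have r: "r < N * N" by simp
  then have N: "N > 0" by (cases N) auto
  have "?l $ r = (\<Sum>p\<in>{..<N} \<times> {..<N}. case p of (b, c) \<Rightarrow> (h b c \<cdot>\<^sub>v (unit_vec N b \<otimes>\<^sub>v unit_vec N c)) $ r)"
    by (subst index_finsum_vec[OF _ r vs]) (auto intro!: sum.cong)
  also have "\<dots> = (\<Sum>p\<in>{..<N} \<times> {..<N}. if p = (r div N, r mod N) then h (r div N) (r mod N) else 0)"
  proof (intro sum.cong refl)
    fix p assume "p \<in> {..<N} \<times> {..<N}"
    then obtain b c where p: "p = (b, c)" "b < N" "c < N" by auto
    have "r = b * N + c \<longleftrightarrow> b = r div N \<and> c = r mod N"
      using p by auto
    then show "(case p of (b, c) \<Rightarrow> (h b c \<cdot>\<^sub>v (unit_vec N b \<otimes>\<^sub>v unit_vec N c)) $ r) =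
        (if p = (r div N, r mod N) then h (r div N) (r mod N) else 0)"
      using p r mult_add_less_square[OF p(2,3)] by (auto simp: tensor_unit_vec)
  qed
  also have "\<dots> = h (r div N) (r mod N)"
    using r N by (simp add: less_mult_imp_div_less)
  finally show "?l $ r = ?r $ r"
    using r by simp
qed

text \<open>Bridge to the formulation by images of basis tensors: a matrix is determined by its
  columns. \<open>H\<close> is the kernel on natural indices, \<open>F\<close> its extension to the
  integers.\<close>

lemma eq_smult_kmat_iff_columns:
  assumes L: "L \<in> carrier_mat (N * N) (N * N)"
    and H: "\<And>s t b c. H s t b c = F (int s) (int t) (int b) (int c)"
  shows "L = a \<cdot>\<^sub>m kmat N F \<longleftrightarrow> (\<forall>s<N. \<forall>t<N. L *\<^sub>v (unit_vec N s \<otimes>\<^sub>v unit_vec N t) =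
    a \<cdot>\<^sub>v finsum_vec TYPE(complex) (N * N)
      (\<lambda>(b, c). H s t b c \<cdot>\<^sub>v (unit_vec N b \<otimes>\<^sub>v unit_vec N c)) ({..<N} \<times> {..<N}))"
    (is "_ \<longleftrightarrow> ?cols")
proof -
  have column: "(L *\<^sub>v (unit_vec N s \<otimes>\<^sub>v unit_vec N t) = a \<cdot>\<^sub>v finsum_vec TYPE(complex) (N * N)
      (\<lambda>(b, c). H s t b c \<cdot>\<^sub>v (unit_vec N b \<otimes>\<^sub>v unit_vec N c)) ({..<N} \<times> {..<N})) \<longleftrightarrow>
      (\<forall>r<N * N. L $$ (r, s * N + t) = (a \<cdot>\<^sub>m kmat N F) $$ (r, s * N + t))"
    if st: "s < N" "t < N" for s t
  proof -
    have "L *\<^sub>v (unit_vec N s \<otimes>\<^sub>v unit_vec N t) = col L (s * N + t)"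
      using L mult_add_less_square[OF st]
      by (intro eq_vecI) (auto simp: tensor_unit_vec[OF st] scalar_prod_right_unit)
    then show ?thesis
      unfolding finsum_tensor_unit_vec
      using L mult_add_less_square[OF st] st by (auto simp: vec_eq_iff H kmat_def)
  qed
  show ?thesis
  proof
    assume "L = a \<cdot>\<^sub>m kmat N F"
    with column show ?cols by blast
  next
    assume cols: ?cols
    show "L = a \<cdot>\<^sub>m kmat N F"
    proof (rule eq_matI)
      fix r k assume "r < dim_row (a \<cdot>\<^sub>m kmat N F)" "k < dim_col (a \<cdot>\<^sub>m kmat N F)"
      then have rk: "r < N * N" "k < N * N" by simp_all
      then have "N > 0" by (cases N) auto
      then have st: "k div N < N" "k mod N < N" using rk by (auto simp: less_mult_imp_div_less)
      with column[OF st] cols rk show "L $$ (r, k) = (a \<cdot>\<^sub>m kmat N F) $$ (r, k)"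
        by simp
    qed (use L in auto)
  qed
qed

section \<open>Discrete Fourier transforms\<close>

text \<open>The last two assumptions say that \<open>q\<^sup>2\<close> has order \<open>N\<close>.
  The finer sign condition \<open>q_power_N\<close> enters through \<open>f_N\<close> and
  \<open>Q_N_square\<close>.\<close>

locale unity_root =
  fixes N :: nat and q :: complex
  assumes N_pos: "N > 0"
    and q_power_N: "q ^ N = (-1) ^ (N + 1)"
    and q2_power_N: "(q\<^sup>2) ^ N = 1"
    and q2_primitive: "\<And>k. 0 < k \<Longrightarrow> k < N \<Longrightarrow> (q\<^sup>2) ^ k \<noteq> 1"
begin

section \<open>Characters of the cyclic group of order N\<close>

lemma q_nonzero [simp]: "q \<noteq> 0"
  using q2_power_N N_pos by (auto simp: power_0_left)

lemma Q_add: "q powi (m + n) = q powi m * q powi n"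
  by (simp add: power_int_add)

lemma Q_dvd:
  assumes "int N dvd n"
  shows "q powi (2 * n) = 1"
proof -
  obtain k where "n = int N * k" using assms by (rule dvdE)
  then have "q powi (2 * n) = (q powi (int (2 * N))) powi k"
    by (simp only: power_int_mult[symmetric]) (simp add: mult.assoc)
  also have "q powi (int (2 * N)) = 1"
    using q2_power_N by (simp only: power_int_of_nat power_mult)
  finally show ?thesis by simp
qed

lemma Q_cong:
  assumes "int N dvd m - n"
  shows "q powi (2 * m) = q powi (2 * n)"
proof -
  have "q powi (2 * m) = q powi (2 * n) * q powi (2 * (m - n))"
    by (simp flip: Q_add add: algebra_simps)
  then show ?thesis using Q_dvd[OF assms] by simp
qed

lemma Q_eq_1_iff: "q powi (2 * n) = 1 \<longleftrightarrow> int N dvd n"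
proof
  assume 1: "q powi (2 * n) = 1"
  define k where "k = nat (n mod int N)"
  have k: "int k = n mod int N" using N_pos by (simp add: k_def)
  have "int N dvd int k - n" by (simp add: k flip: mod_eq_dvd_iff)
  then have "q powi (2 * int k) = 1" using Q_cong[of "int k" n] 1 by simp
  then have "(q\<^sup>2) ^ k = 1"
    by (metis of_nat_mult of_nat_numeral power_int_of_nat power_mult)
  moreover have "k < N" using k N_pos by (metis of_nat_0_less_iff of_nat_less_iff pos_mod_bound)
  ultimately have "k = 0" using q2_primitive by blast
  then show "int N dvd n" using k by (simp add: dvd_eq_mod_eq_0)
qed (rule Q_dvd)

text \<open>Orthogonality of characters: off the multiples of \<open>N\<close> this is a geometric
  sum whose ratio differs from 1 but has \<open>N\<close>-th power 1.\<close>

lemma sum_Q: "(\<Sum>t<N. q powi (2 * (n * int t))) = (if int N dvd n then of_nat N else 0)"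
proof (cases "int N dvd n")
  case True
  then have "q powi (2 * (n * int t)) = 1" for t
    by (intro Q_dvd) simp
  then show ?thesis using True by simp
next
  case False
  let ?x = "q powi (2 * n)"
  have "?x \<noteq> 1" using False Q_eq_1_iff by blast
  moreover have "?x ^ N = 1"
  proof -
    have "?x ^ N = q powi (2 * (n * int N))"
      by (simp flip: power_int_of_nat power_int_mult add: mult.assoc)
    then show ?thesis by (simp add: Q_dvd)
  qed
  moreover have "q powi (2 * (n * int t)) = ?x ^ t" for t
    by (simp flip: power_int_of_nat power_int_mult add: mult.assoc)
  ultimately show ?thesis using False by (simp add: sum_gp_strict)
qed

text \<open>The eigenvalues of \<open>B1\<close> are distinct. This provides the interpolation
  points in \<open>prod_one_minus_Q\<close> and removes the off-diagonal entries in
  \<open>commutant_X'_scalar\<close>.\<close>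

lemma Q_inj:
  assumes "int u < int N" "int w < int N" "q powi (2 * int u) = q powi (2 * int w)"
  shows "u = w"
proof -
  have "q powi (2 * (int u - int w)) * q powi (2 * int w) = q powi (2 * int u)"
    by (simp flip: Q_add add: algebra_simps)
  then have "q powi (2 * (int u - int w)) = 1"
    using assms(3) by simp
  then have "int N dvd int u - int w" using Q_eq_1_iff by blast
  then have "int u mod int N = int w mod int N" by (simp add: mod_eq_dvd_iff)
  then show ?thesis using assms by simp
qed

text \<open>Both sides are polynomials in \<open>x\<close> of degree at most \<open>N\<close>. They
  agree at \<open>N + 1\<close> points: both are 1 at 0, and both vanish at the \<open>N\<close>
  powers of \<open>q\<^sup>2\<close>.\<close>

lemma prod_one_minus_Q: "(\<Prod>u=1..N. 1 - x * q powi (- 2 * int u)) = 1 - x ^ N"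
proof -
  define P where "P = (\<Prod>u=1..N. [:1, - (q powi (- 2 * int u)):])"
  define R where "R = [:1:] - monom (1 :: complex) N"
  define A where "A = insert 0 ((\<lambda>u. q powi (2 * int u)) ` {..<N})"
  have inj: "inj_on (\<lambda>u. q powi (2 * int u)) {..<N}"
    by (rule inj_onI) (use Q_inj in auto)
  have "card A = Suc N"
    unfolding A_def using inj by (subst card_insert_disjoint) (auto simp: card_image)
  moreover have "degree P \<le> N"
  proof -
    have "degree P \<le> (\<Sum>u=1..N. degree [:1, - (q powi (- 2 * int u)):])"
      unfolding P_def by (rule order.trans[OF degree_prod_sum_le]) (simp_all add: o_def)
    also have "\<dots> \<le> (\<Sum>u=1..N. 1)"
      by (intro sum_mono) simp
    finally show ?thesis by simp
  qed
  moreover have "degree R \<le> N"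
    unfolding R_def by (intro degree_diff_le) (auto simp: degree_monom_le)
  moreover have "poly P x = poly R x" if xA: "x \<in> A" for x
  proof (cases "x = 0")
    case True
    then show ?thesis using N_pos by (simp add: P_def R_def poly_prod poly_monom power_0_left)
  next
    case False
    then obtain u where u: "x = q powi (2 * int u)" "u < N" using xA unfolding A_def by blast
    \<comment> \<open>The product runs over \<open>1..N\<close>, so the residue 0 is represented
      there by \<open>N\<close>.\<close>
    define w where "w = (if u = 0 then N else u)"
    have w: "w \<in> {1..N}" "x = q powi (2 * int w)"
      using u N_pos Q_dvd[of "int N"] by (auto simp: w_def)
    have "1 - x * q powi (- 2 * int w) = 0"
      unfolding w(2) by (simp flip: Q_add)
    then have "poly P x = 0"
      using w(1) by (auto simp: P_def poly_prod intro!: prod_zero bexI[of _ w])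
    moreover have "x ^ N = q powi (2 * (int u * int N))"
      unfolding u by (simp flip: power_int_of_nat power_int_mult add: mult.assoc)
    then have "poly R x = 0" by (simp add: R_def poly_monom Q_dvd)
    ultimately show ?thesis by simp
  qed
  ultimately have "P = R" by (intro poly_eqI_degree[of A]) auto
  then have "poly P x = poly R x" by simp
  then show ?thesis by (simp add: P_def R_def poly_prod poly_monom)
qed

definition dft :: "(nat \<Rightarrow> complex) \<Rightarrow> int \<Rightarrow> complex" where
  "dft h n = (\<Sum>a<N. h a * q powi (2 * (int a * n)))"

text \<open>Inverts circulants: the matrix with entries \<open>dft h (m - n)\<close> has the
  eigenvalues \<open>N h(a)\<close>, so for nonvanishing \<open>h\<close> its inverse has the
  entries \<open>dft_dual h (n - m)\<close> divided by \<open>N\<^sup>2\<close>.\<close>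

definition dft_dual :: "(nat \<Rightarrow> complex) \<Rightarrow> int \<Rightarrow> complex" where
  "dft_dual h n = (\<Sum>a<N. inverse (h a) * q powi (2 * (- (int a * n))))"

lemma dft_cong: "int N dvd m - n \<Longrightarrow> dft h m = dft h n"
  unfolding dft_def by (intro sum.cong refl arg_cong2[where f = "(*)"] Q_cong)
    (simp flip: right_diff_distrib)

text \<open>Summing over \<open>t\<close> first forces \<open>a = a'\<close> and cancels
  \<open>h\<close> against its inverse; the remaining character sum over \<open>a\<close> gives the
  condition on \<open>m - n\<close>. The sign \<open>\<epsilon>\<close> allows for a summation
  variable entering as \<open>t\<close> or as \<open>- t\<close>.\<close>

lemma sum_dft_dft_dual:
  fixes \<epsilon> :: int
  assumes h: "\<And>a. a < N \<Longrightarrow> h a \<noteq> 0" and \<epsilon>: "\<epsilon> = 1 \<or> \<epsilon> = -1"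
  shows "(\<Sum>t<N. dft h (\<epsilon> * int t + m) * dft_dual h (\<epsilon> * int t + n)) =
    of_nat (N * N) * of_bool (int N dvd m - n)"
proof -
  let ?C = "\<lambda>a a'. h a * inverse (h a') * q powi (2 * (int a * m - int a' * n))"
  have "(\<Sum>t<N. dft h (\<epsilon> * int t + m) * dft_dual h (\<epsilon> * int t + n)) =
      (\<Sum>t<N. \<Sum>a<N. \<Sum>a'<N. ?C a a' * q powi (2 * ((\<epsilon> * (int a - int a')) * int t)))"
    unfolding dft_def dft_dual_def sum_product
  proof (intro sum.cong refl)
    fix t a a'
    have "q powi (2 * (int a * (\<epsilon> * int t + m))) * q powi (2 * (- (int a' * (\<epsilon> * int t + n)))) =
        q powi (2 * (int a * m - int a' * n)) * q powi (2 * ((\<epsilon> * (int a - int a')) * int t))"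
      by (simp flip: Q_add add: algebra_simps)
    then show "h a * q powi (2 * (int a * (\<epsilon> * int t + m))) *
        (inverse (h a') * q powi (2 * (- (int a' * (\<epsilon> * int t + n))))) =
        ?C a a' * q powi (2 * ((\<epsilon> * (int a - int a')) * int t))"
      by (simp add: mult_ac)
  qed
  also have "\<dots> = (\<Sum>a<N. \<Sum>t<N. \<Sum>a'<N. ?C a a' * q powi (2 * ((\<epsilon> * (int a - int a')) * int t)))"
    by (rule sum.swap)
  also have "\<dots> = (\<Sum>a<N. \<Sum>a'<N. \<Sum>t<N. ?C a a' * q powi (2 * ((\<epsilon> * (int a - int a')) * int t)))"
    by (rule sum.cong[OF refl], rule sum.swap)
  also have "\<dots> = (\<Sum>a<N. \<Sum>a'<N. ?C a a' * (\<Sum>t<N. q powi (2 * ((\<epsilon> * (int a - int a')) * int t))))"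
    by (simp only: sum_distrib_left)
  also have "\<dots> = (\<Sum>a<N. \<Sum>a'<N. if a' = a then of_nat N * q powi (2 * ((m - n) * int a)) else 0)"
  proof (intro sum.cong refl)
    fix a a' assume a: "a \<in> {..<N}" "a' \<in> {..<N}"
    have "int N dvd \<epsilon> * (int a - int a') \<longleftrightarrow> int N dvd int a - int a'"
      using \<epsilon> by (auto simp: dvd_diff_commute)
    also have "\<dots> \<longleftrightarrow> a' = a"
      using a by (auto simp flip: mod_eq_dvd_iff)
    finally show "?C a a' * (\<Sum>t<N. q powi (2 * ((\<epsilon> * (int a - int a')) * int t))) =
        (if a' = a then of_nat N * q powi (2 * ((m - n) * int a)) else 0)"
      using a h[of a] by (simp only: sum_Q) (auto simp: algebra_simps)
  qed
  also have "\<dots> = of_nat N * (\<Sum>a<N. q powi (2 * ((m - n) * int a)))"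
    by (simp add: sum_distrib_left)
  finally show ?thesis by (simp add: sum_Q)
qed

end

section \<open>The kernel of the intertwiner\<close>

locale square_flip = unity_root +
  fixes y v :: "side \<Rightarrow> complex" and z :: int
  assumes y_nonzero [simp]: "y s \<noteq> 0" and v_nonzero [simp]: "v s \<noteq> 0"
    and y_Si: "y Si ^ N \<noteq> -1"
    and v_Si: "v Si = q powi (2 * z) * inverse (y Si)"
    and v_Sj: "v Sj ^ N = (1 + y Si ^ N) * y Sj ^ N"
    and v_Sk: "v Sk ^ N = inverse (1 + inverse (y Si ^ N)) * y Sk ^ N"
    and v_Sl: "v Sl ^ N = (1 + y Si ^ N) * y Sl ^ N"
    and prod_eq: "y Si * y Sj * y Sk * y Sl * y Sm = v Si * v Sj * v Sk * v Sl * v Sm"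
begin

abbreviation "f \<equiv> f_coeff q y v z"
text \<open>\<open>\<mu>\<close> is the base of the power in \<open>L_coeff\<close>, and
  \<open>r\<close> is the ratio of the geometric sequence in \<open>p_poly\<close>.\<close>

definition "\<mu> = y Sj * y Sk * y Si / (v Sj * v Sk)"
definition "r = y Sl * y Sk * y Si / (v Sl * v Sk)"

lemma \<mu>_nonzero [simp]: "\<mu> \<noteq> 0" by (simp add: \<mu>_def)
lemma r_nonzero [simp]: "r \<noteq> 0" by (simp add: r_def)

lemma one_plus_y_Si: "1 + y Si ^ N \<noteq> 0"
  using y_Si by (simp add: add_eq_0_iff eq_commute[of "- 1"] minus_equation_iff)

text \<open>With \<open>x\<close> for \<open>y Si ^ N\<close>, the product of \<open>1 + x\<close>
  and \<open>inverse (1 + inverse x)\<close> is \<open>x\<close>, which matches the factor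
  \<open>y Si\<close> in the numerator.\<close>

lemma \<mu>_power: "\<mu> ^ N = 1"
proof -
  have "\<mu> ^ N = y Sj ^ N * y Sk ^ N * y Si ^ N / (v Sj ^ N * v Sk ^ N)"
    by (simp add: \<mu>_def power_mult_distrib power_divide)
  also have "\<dots> = 1"
    unfolding v_Sj v_Sk using one_plus_y_Si by (simp add: inverse_eq_divide divide_simps)
  finally show ?thesis .
qed

lemma r_power: "r ^ N = 1"
proof -
  have "r ^ N = y Sl ^ N * y Sk ^ N * y Si ^ N / (v Sl ^ N * v Sk ^ N)"
    by (simp add: r_def power_mult_distrib power_divide)
  also have "\<dots> = 1"
    unfolding v_Sl v_Sk using one_plus_y_Si by (simp add: inverse_eq_divide divide_simps)
  finally show ?thesis .
qed

section \<open>The sequence f over one period and the two transforms\<close>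

lemma f_0: "f 0 = 1" by (simp add: f_coeff_def)

lemma f_Suc: "f (Suc a) = y Sj / v Sj * (1 + y Si * q powi (1 - 2 * (int a + 1 + z))) * f a"
  by (simp add: f_coeff_def algebra_simps)

text \<open>The product over a full period is \<open>1 + y Si ^ N\<close> by
  \<open>prod_one_minus_Q\<close>, and the prefactor is its inverse by \<open>v_Sj\<close>.\<close>

lemma f_N: "f N = 1"
proof -
  let ?x = "- (y Si * q powi (1 - 2 * z))"
  have "(\<Prod>u=1..N. 1 + y Si * q powi (1 - 2 * (int u + z))) = (\<Prod>u=1..N. 1 - ?x * q powi (- 2 * int u))"
  proof (rule prod.cong[OF refl])
    fix u :: nat
    have "q powi (1 - 2 * (int u + z)) = q powi (1 - 2 * z) * q powi (- 2 * int u)"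
      by (simp flip: Q_add add: algebra_simps)
    then show "1 + y Si * q powi (1 - 2 * (int u + z)) = 1 - ?x * q powi (- 2 * int u)"
      by (simp add: mult.assoc)
  qed
  also have "\<dots> = 1 - ?x ^ N" by (rule prod_one_minus_Q)
  \<comment> \<open>The sign \<open>(-1) ^ N\<close> of \<open>?x\<close> and the value
    \<open>(-1) ^ (N + 1)\<close> of \<open>q ^ N\<close> combine to -1 for either parity.\<close>
  also have "?x ^ N = - (y Si ^ N)"
  proof -
    have "(q powi (1 - 2 * z)) ^ N = q powi (int N + 2 * (int N * (- z)))"
      by (simp flip: power_int_of_nat power_int_mult add: algebra_simps)
    also have "\<dots> = q ^ N" unfolding Q_add using Q_dvd[of "int N * (- z)"] by simp
    finally have "(q powi (1 - 2 * z)) ^ N = q ^ N" .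
    then have "?x ^ N = (-1) ^ N * (y Si ^ N * (-1) ^ (N + 1))"
      unfolding q_power_N[symmetric] by (subst power_minus) (simp add: power_mult_distrib)
    also have "\<dots> = - (y Si ^ N)"
      by (cases "even N") simp_all
    finally show ?thesis .
  qed
  finally have "f N = (y Sj / v Sj) ^ N * (1 + y Si ^ N)"
    by (simp add: f_coeff_def)
  then show ?thesis
    using one_plus_y_Si by (simp add: power_divide v_Sj)
qed

text \<open>By the recursion a zero would propagate up to \<open>f N\<close>, which is 1.\<close>

lemma f_nonzero:
  assumes "a \<le> N" shows "f a \<noteq> 0"
proof
  assume 0: "f a = 0"
  have "f (a + k) = 0" for k
    by (induction k) (simp_all add: 0 f_Suc)
  from this[of "N - a"] show False using assms f_N by simp
qed

definition "G n = dft f n"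
definition "P n = dft (\<lambda>d. r ^ d) n"

text \<open>Shifting the summation index leaves the transform unchanged; applying
  \<open>f_Suc\<close> termwise then gives a multiple of \<open>G n\<close>, and a second term whose
  factor \<open>q powi (- 2 * int a)\<close> lowers the frequency to \<open>n - 1\<close>.\<close>

lemma G_recursion:
  "G n + y Si * q powi (- 1 - 2 * z) * G (n - 1) = v Sj / y Sj * q powi (- 2 * n) * G n"
proof -
  let ?h = "\<lambda>a. f a * q powi (2 * (int a * n))"
  \<comment> \<open>The boundary terms \<open>?h 0\<close> and \<open>?h N\<close> are both 1 and
    cancel.\<close>
  have "?h 0 + (\<Sum>a<N. ?h (Suc a)) = (\<Sum>a<Suc N. ?h a)"
    by (rule sum.lessThan_Suc_shift[symmetric])
  also have "\<dots> = (\<Sum>a<N. ?h a) + ?h N"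
    by (rule sum.lessThan_Suc)
  finally have shift: "(\<Sum>a<N. ?h (Suc a)) = G n"
    by (simp add: f_0 f_N G_def dft_def Q_dvd)
  have "?h (Suc a) = y Sj / v Sj * q powi (2 * n) *
      (?h a + y Si * q powi (- 1 - 2 * z) * (f a * q powi (2 * (int a * (n - 1)))))" for a
  proof -
    have "q powi (2 * (int (Suc a) * n)) = q powi (2 * n) * q powi (2 * (int a * n))"
      by (simp flip: Q_add add: algebra_simps)
    moreover have "q powi (1 - 2 * (int a + 1 + z)) * q powi (2 * (int a * n)) =
        q powi (- 1 - 2 * z) * q powi (2 * (int a * (n - 1)))"
      by (simp flip: Q_add add: algebra_simps)
    ultimately show ?thesis
      unfolding f_Suc by (simp add: algebra_simps)
  qed
  then have "G n = (\<Sum>a<N. y Sj / v Sj * q powi (2 * n) *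
      (?h a + y Si * q powi (- 1 - 2 * z) * (f a * q powi (2 * (int a * (n - 1))))))"
    unfolding shift[symmetric] by (rule sum.cong[OF refl])
  also have "\<dots> = y Sj / v Sj * q powi (2 * n) * (G n + y Si * q powi (- 1 - 2 * z) * G (n - 1))"
    by (simp only: G_def dft_def sum.distrib sum_distrib_left[symmetric])
  finally have "G n = y Sj / v Sj * q powi (2 * n) * (G n + y Si * q powi (- 1 - 2 * z) * G (n - 1))" .
  moreover have "q powi (- 2 * n) * q powi (2 * n) = 1"
    by (simp flip: Q_add)
  moreover have "v Sj / y Sj * b * x = e" if "x = y Sj / v Sj * a * e" "b * a = 1" for a b e x
    using that by (simp add: mult_ac)
  ultimately show ?thesis by metis
qed

text \<open>\<open>P n\<close> is a geometric sum with ratio \<open>?x\<close> satisfying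
  \<open>?x ^ N = 1\<close>, so either the ratio is 1 or the sum vanishes.\<close>

lemma P_root: "P n * (r * q powi (2 * n)) = P n"
proof -
  let ?x = "r * q powi (2 * n)"
  have "?x ^ d = r ^ d * q powi (2 * (int d * n))" for d
    by (simp add: power_mult_distrib) (simp flip: power_int_of_nat power_int_mult add: mult_ac)
  then have P: "P n = (\<Sum>d<N. ?x ^ d)" and "?x ^ N = 1"
    by (simp_all add: P_def dft_def r_power Q_dvd)
  then have "(?x - 1) * P n = 0"
    using power_diff_1_eq[of ?x N] by (simp add: P)
  then show ?thesis by (simp add: algebra_simps)
qed

section \<open>The kernel and its five identities\<close>

definition phase :: "int \<Rightarrow> int \<Rightarrow> int \<Rightarrow> complex" where
  "phase s b c = q powi (- s\<^sup>2 + 2 * z * (b - c - z) + 2 * b * c)"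

text \<open>\<open>L_coeff\<close> continued to integer indices, with its sums over \<open>d\<close>
  and \<open>a\<close> read as transforms.\<close>

definition LF :: "int \<Rightarrow> int \<Rightarrow> int \<Rightarrow> int \<Rightarrow> complex" where
  "LF s t b c = phase s b c * \<mu> powi (c + z) * P (s + t - c - z) * G (b - s)"

lemma L_coeff_eq_LF: "L_coeff N q y v z s t b c = LF (int s) (int t) (int b) (int c)"
proof -
  have "P n = p_poly N y v (q powi (2 * n))" for n
    by (simp add: P_def dft_def p_poly_def r_def power_mult_distrib mult_ac
      flip: power_int_of_nat power_int_mult)
  then show ?thesis
    by (simp add: L_coeff_def LF_def phase_def \<mu>_def G_def dft_def mult_ac)
qed

text \<open>The simultaneous shifts preserve \<open>s + t\<close> and \<open>b - s\<close>, so only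
  the phase changes; what it loses is made up by
  \<open>y Si * v Si = q powi (2 * z)\<close>.\<close>

lemma LF_Xi: "y Si * q powi (2 * c) * (v Si * q powi (1 - 2 * s) * LF (s - 1) (t + 1) (b - 1) c) = LF s t b c"
proof -
  have "phase s b c = q powi (2 * c) * q powi (2 * z) * q powi (1 - 2 * s) * phase (s - 1) (b - 1) c"
    by (simp flip: Q_add add: phase_def algebra_simps power2_eq_square)
  then show ?thesis by (simp add: LF_def v_Si)
qed

text \<open>Entries of the relation for \<open>1 + q X_i\<close> times \<open>X_j\<close>: the two
  terms on the right are merged by \<open>G_recursion\<close> at \<open>b - s\<close>.\<close>

lemma LF_Xj: "v Sj * q powi (2 * s) * LF s t b c =
    y Sj * q powi (2 * b) * LF s t b c + q * (y Si * q powi (2 * c) * (y Sj * q powi (2 * (b - 1)) * LF s t (b - 1) c))"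
proof -
  have phase: "q * q powi (2 * c) * q powi (2 * (b - 1)) * phase s (b - 1) c =
      q powi (2 * b) * q powi (- 1 - 2 * z) * phase s b c"
    by (simp flip: Q_add power_int_add_1 power_int_add_1' add: phase_def algebra_simps power2_eq_square)
  have Q: "q powi (2 * s) = q powi (2 * b) * q powi (- 2 * (b - s))"
    by (simp flip: Q_add)
  let ?A = "\<mu> powi (c + z) * P (s + t - c - z)"
  have "y Sj * q powi (2 * b) * LF s t b c + q * (y Si * q powi (2 * c) * (y Sj * q powi (2 * (b - 1)) * LF s t (b - 1) c))
    = y Sj * ?A * (q powi (2 * b) * phase s b c * G (b - s) +
        (q * q powi (2 * c) * q powi (2 * (b - 1)) * phase s (b - 1) c) * y Si * G (b - s - 1))"
    by (simp add: LF_def algebra_simps)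
  also have "\<dots> = y Sj * ?A * q powi (2 * b) * phase s b c *
      (G (b - s) + y Si * q powi (- 1 - 2 * z) * G (b - s - 1))"
    unfolding phase by (simp add: algebra_simps)
  also have "\<dots> = v Sj * q powi (2 * s) * LF s t b c"
    unfolding G_recursion Q by (simp add: LF_def)
  finally show ?thesis by simp
qed

text \<open>Entries of the relation for \<open>X_k\<close> with its denominator cleared:
  \<open>G_recursion\<close> at \<open>b - s - 1\<close> merges the left side, and the step from
  \<open>c\<close> to \<open>c - 1\<close> costs one factor \<open>\<mu>\<close>.\<close>

lemma LF_Xk: "y Si * q powi (2 * c) * (v Sk * LF (s + 1) t (b - 1) c) + q * (v Sk * LF (s + 1) t b c) =
    y Si * q powi (2 * c) * (y Sk * LF s t (b - 1) (c - 1))"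
proof -
  have phase1: "q powi (2 * c) * phase (s + 1) (b - 1) c = q powi (- 2 * s) * q powi (- 1 - 2 * z) * phase s b c"
    and phase2: "q * phase (s + 1) b c = q powi (- 2 * s) * phase s b c"
    and phase3: "q powi (2 * c) * phase s (b - 1) (c - 1) = q powi (- 2 * s) * q powi (- 2 * (b - s - 1)) * phase s b c"
    by (simp_all flip: Q_add power_int_add_1 power_int_add_1' add: phase_def algebra_simps power2_eq_square)
  let ?A = "\<mu> powi (c + z) * P (s + t + 1 - c - z)"
  \<comment> \<open>One factor \<open>\<mu>\<close> trades \<open>y Si * y Sk\<close> for
    \<open>v Sk * (v Sj / y Sj)\<close>, the coefficient that \<open>G_recursion\<close>
    produces.\<close>
  have \<mu>: "\<mu> powi (c - 1 + z) * (y Si * y Sk) = \<mu> powi (c + z) * (v Sk * (v Sj / y Sj))"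
  proof -
    have "\<mu> powi (c + z) = \<mu> powi (c - 1 + z) * \<mu>"
      by (simp flip: power_int_add_1)
    then show ?thesis by (simp add: \<mu>_def)
  qed
  have arg: "s + 1 + t - c - z = s + t + 1 - c - z" "s + t - (c - 1) - z = s + t + 1 - c - z"
    "b - 1 - (s + 1) = b - s - 1 - 1" "b - (s + 1) = b - s - 1" "b - 1 - s = b - s - 1"
    by simp_all
  have "y Si * q powi (2 * c) * (v Sk * LF (s + 1) t (b - 1) c) + q * (v Sk * LF (s + 1) t b c) =
    v Sk * ?A * ((q powi (2 * c) * phase (s + 1) (b - 1) c) * y Si * G (b - s - 1 - 1) +
      (q * phase (s + 1) b c) * G (b - s - 1))"
    unfolding LF_def arg by (simp only: algebra_simps)
  also have "\<dots> = v Sk * ?A * q powi (- 2 * s) * phase s b c *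
      (G (b - s - 1) + y Si * q powi (- 1 - 2 * z) * G (b - s - 1 - 1))"
    unfolding phase1 phase2 by (simp only: algebra_simps)
  also have "\<dots> = (\<mu> powi (c + z) * (v Sk * (v Sj / y Sj))) * P (s + t + 1 - c - z) *
      (q powi (- 2 * s) * q powi (- 2 * (b - s - 1)) * phase s b c) * G (b - s - 1)"
    unfolding G_recursion by (simp only: mult_ac)
  also have "\<dots> = y Si * q powi (2 * c) * (y Sk * LF s t (b - 1) (c - 1))"
    unfolding \<mu>[symmetric] phase3[symmetric] LF_def arg by (simp only: mult_ac)
  finally show ?thesis .
qed

text \<open>After \<open>G_recursion\<close> at \<open>b - s\<close>, the power of \<open>q\<close>
  and the ratio \<open>r\<close> coming from the shift of \<open>c\<close> form exactly the factor
  that \<open>P_root\<close> absorbs.\<close>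

lemma LF_Xl: "v Sl * q powi (1 - 2 * t) * LF s (t - 1) b c =
    y Sl * q powi (1 - 2 * (c + 1)) * LF s t b (c + 1) +
    q * (y Si * q powi (2 * c) * (y Sl * q powi (1 - 2 * (c + 1)) * LF s t (b - 1) (c + 1)))"
proof -
  let ?m = "s + t - c - 1 - z"
  let ?E = "q powi (- 1 - 2 * c - 2 * z + 2 * b)"
  have phase1: "q powi (1 - 2 * (c + 1)) * phase s b (c + 1) = ?E * phase s b c"
    and phase2: "q * q powi (2 * c) * q powi (1 - 2 * (c + 1)) * phase s (b - 1) (c + 1) =
      ?E * q powi (- 1 - 2 * z) * phase s b c"
    and Q: "?E * q powi (- 2 * (b - s)) = q powi (1 - 2 * t) * q powi (2 * ?m)"
    by (simp_all flip: Q_add power_int_add_1 power_int_add_1' add: phase_def algebra_simps power2_eq_square)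
  have \<mu>: "\<mu> powi (c + 1 + z) * (y Sl * (v Sj / y Sj)) = \<mu> powi (c + z) * (v Sl * r)"
  proof -
    have "\<mu> powi (c + 1 + z) = \<mu> powi (c + z) * \<mu>"
      by (metis \<mu>_nonzero add.assoc add.commute power_int_add_1)
    then show ?thesis by (simp add: \<mu>_def r_def)
  qed
  have arg: "s + t - (c + 1) - z = ?m" "s + (t - 1) - c - z = ?m" "b - 1 - s = b - s - 1"
    by simp_all
  let ?A = "\<mu> powi (c + 1 + z) * P ?m"
  have "y Sl * q powi (1 - 2 * (c + 1)) * LF s t b (c + 1) +
    q * (y Si * q powi (2 * c) * (y Sl * q powi (1 - 2 * (c + 1)) * LF s t (b - 1) (c + 1))) =
    y Sl * ?A * ((q powi (1 - 2 * (c + 1)) * phase s b (c + 1)) * G (b - s) +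
      (q * q powi (2 * c) * q powi (1 - 2 * (c + 1)) * phase s (b - 1) (c + 1)) * y Si * G (b - s - 1))"
    unfolding LF_def arg by (simp only: distrib_left mult_ac)
  also have "\<dots> = y Sl * ?A * ?E * phase s b c * (G (b - s) + y Si * q powi (- 1 - 2 * z) * G (b - s - 1))"
    unfolding phase1 phase2 by (simp only: distrib_left mult_ac)
  also have "\<dots> = (\<mu> powi (c + 1 + z) * (y Sl * (v Sj / y Sj))) * P ?m *
      (?E * q powi (- 2 * (b - s))) * phase s b c * G (b - s)"
    unfolding G_recursion by (simp only: mult_ac)
  also have "\<dots> = \<mu> powi (c + z) * v Sl * (P ?m * (r * q powi (2 * ?m))) * q powi (1 - 2 * t) * phase s b c * G (b - s)"
    unfolding \<mu> Q by (simp only: mult_ac)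
  also have "\<dots> = v Sl * q powi (1 - 2 * t) * LF s (t - 1) b c"
    unfolding P_root LF_def arg by (simp only: mult_ac)
  finally show ?thesis by simp
qed

text \<open>As for \<open>X_l\<close>, \<open>G_recursion\<close> at \<open>b - s\<close> is
  followed by \<open>P_root\<close>, here at \<open>s + t - c - z\<close>; the constants match by
  the equality of the two total products.\<close>

lemma LF_Xm: "y Si * q powi (2 * c) * (v Sm * q powi (2 * t) * LF s t (b - 1) c) + q * (v Sm * q powi (2 * t) * LF s t b c) =
    y Si * q powi (2 * c) * (y Sm * q powi (1 - 2 * b) * LF s t b c)"
proof -
  let ?m = "s + t - c - z"
  let ?n = "b - s"
  have phase1: "q powi (2 * c) * phase s (b - 1) c = q * q powi (- 1 - 2 * z) * phase s b c"
    and Q: "q * q powi (2 * t) * q powi (- 2 * ?n) = q powi (2 * c) * q powi (1 - 2 * b) * q powi (2 * z) * q powi (2 * ?m)"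
    by (simp_all flip: Q_add power_int_add_1 power_int_add_1' add: phase_def algebra_simps power2_eq_square)
  \<comment> \<open>Here \<open>prod_eq\<close> enters, with \<open>v Si\<close> expressed through
    \<open>z\<close>.\<close>
  have r: "v Sm * (v Sj / y Sj) * q powi (2 * z) = y Si * y Sm * r"
    using prod_eq unfolding v_Si r_def by (simp add: field_simps)
  let ?A = "phase s b c * \<mu> powi (c + z) * P ?m"
  have "y Si * q powi (2 * c) * (v Sm * q powi (2 * t) * LF s t (b - 1) c) + q * (v Sm * q powi (2 * t) * LF s t b c) =
    v Sm * (\<mu> powi (c + z) * P ?m) * q powi (2 * t) *
      ((q powi (2 * c) * phase s (b - 1) c) * y Si * G (?n - 1) + q * phase s b c * G ?n)"
    unfolding LF_def by (simp add: algebra_simps)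
  also have "\<dots> = v Sm * ?A * (q * q powi (2 * t)) * (G ?n + y Si * q powi (- 1 - 2 * z) * G (?n - 1))"
    unfolding phase1 by (simp only: distrib_left mult_ac add_ac)
  also have "\<dots> = (v Sm * (v Sj / y Sj)) * ?A * (q * q powi (2 * t) * q powi (- 2 * ?n)) * G ?n"
    unfolding G_recursion by (simp only: mult_ac)
  also have "\<dots> = (v Sm * (v Sj / y Sj) * q powi (2 * z)) * ?A * (q powi (2 * c) * q powi (1 - 2 * b) * q powi (2 * ?m)) * G ?n"
    unfolding Q by (simp only: mult_ac)
  also have "\<dots> = y Si * y Sm * phase s b c * \<mu> powi (c + z) * (P ?m * (r * q powi (2 * ?m))) * q powi (2 * c) * q powi (1 - 2 * b) * G ?n"
    unfolding r by (simp only: mult_ac)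
  also have "\<dots> = y Si * q powi (2 * c) * (y Sm * q powi (1 - 2 * b) * LF s t b c)"
    unfolding P_root LF_def by (simp only: mult_ac)
  finally show ?thesis .
qed

end

section \<open>Intertwining matrices\<close>

context square_flip
begin

text \<open>The columns are now \<open>(b, c)\<close> and the rows \<open>(s, t)\<close>. Scalars
  are inverted and transforms replaced by their duals; each of the two Fourier inversions accounts
  for one factor \<open>1 / N\<^sup>2\<close>.\<close>

definition LF_inv :: "int \<Rightarrow> int \<Rightarrow> int \<Rightarrow> int \<Rightarrow> complex" where
  "LF_inv b c s t = (inverse (of_nat (N * N)))\<^sup>2 * inverse (phase s b c) * inverse (\<mu> powi (c + z)) *
    dft_dual (\<lambda>d. r ^ d) (s + t - c - z) * dft_dual f (b - s)"

section \<open>Periodicity and invertibility of the kernel\<close>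

lemma phase_nonzero [simp]: "phase s b c \<noteq> 0"
  by (simp add: phase_def)

text \<open>\<open>q ^ N\<close> is a sign to the power \<open>N + 1\<close>, and
  \<open>N (N + 1)\<close> is even.\<close>

lemma Q_N_square: "q powi (int N * int N) = 1"
proof -
  have "q powi (int N * int N) = (q ^ N) ^ N"
    by (simp flip: power_int_of_nat power_int_mult)
  then show ?thesis
    unfolding q_power_N by (cases "even N") simp_all
qed

text \<open>In \<open>b\<close> and \<open>c\<close> the exponent is affine with even slope. In
  \<open>s\<close> it contains \<open>- s\<^sup>2\<close> undoubled, and the extra
  \<open>q powi (int N * int N)\<close> is 1 by \<open>Q_N_square\<close>.\<close>

lemma phase_periodic:
  "phase (s + int N) b c = phase s b c" "phase s (b + int N) c = phase s b c"
  "phase s b (c + int N) = phase s b c"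
proof -
  have "phase s b c = phase (s + int N) b c * q powi (2 * (int N * s)) * q powi (int N * int N)"
    by (simp flip: Q_add add: phase_def algebra_simps power2_eq_square)
  then show "phase (s + int N) b c = phase s b c" by (simp add: Q_dvd Q_N_square)
  have "phase s (b + int N) c = phase s b c * q powi (2 * (int N * (z + c)))"
    by (simp flip: Q_add add: phase_def algebra_simps power2_eq_square)
  then show "phase s (b + int N) c = phase s b c" by (simp add: Q_dvd)
  have "phase s b (c + int N) = phase s b c * q powi (2 * (int N * (b - z)))"
    by (simp flip: Q_add add: phase_def algebra_simps power2_eq_square)
  then show "phase s b (c + int N) = phase s b c" by (simp add: Q_dvd)
qed

lemma \<mu>_periodic: "\<mu> powi (c + int N + z) = \<mu> powi (c + z)"
proof -
  have "\<mu> powi (c + int N + z) = \<mu> powi (c + z) * \<mu> powi (int N)"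
    by (simp only: power_int_add[symmetric] \<mu>_nonzero simp_thms add_ac)
  then show ?thesis by (simp add: \<mu>_power)
qed

lemma LF_periodic:
  "LF (s + int N) t b c = LF s t b c" "LF s (t + int N) b c = LF s t b c"
  "LF s t (b + int N) c = LF s t b c" "LF s t b (c + int N) = LF s t b c"
proof -
  have cong: "P m = P n" "G m = G n" if "int N dvd m - n" for m n
    using that by (simp_all add: P_def G_def dft_cong)
  have "P (s + int N + t - c - z) = P (s + t - c - z)" "G (b - (s + int N)) = G (b - s)"
    "P (s + (t + int N) - c - z) = P (s + t - c - z)" "G (b + int N - s) = G (b - s)"
    "P (s + t - (c + int N) - z) = P (s + t - c - z)"
    by (rule cong; simp)+
  then show "LF (s + int N) t b c = LF s t b c" "LF s (t + int N) b c = LF s t b c"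
    "LF s t (b + int N) c = LF s t b c" "LF s t b (c + int N) = LF s t b c"
    by (simp_all only: LF_def phase_periodic \<mu>_periodic)
qed

lemma Q_periodic:
  "q powi (2 * (n + int N)) = q powi (2 * n)" "q powi (1 - 2 * (n + int N)) = q powi (1 - 2 * n)"
proof -
  show "q powi (2 * (n + int N)) = q powi (2 * n)" by (rule Q_cong) simp
  have "q powi (1 - 2 * (n + int N)) = q powi (1 - 2 * n) * q powi (2 * (- int N))"
    by (simp flip: Q_add add: algebra_simps)
  then show "q powi (1 - 2 * (n + int N)) = q powi (1 - 2 * n)"
    using Q_dvd[of "- int N"] by simp
qed

lemmas Q_periodic' = Q_periodic Q_periodic[unfolded distrib_left]

text \<open>The sum over the second inner index inverts the transform \<open>P\<close> and forces
  \<open>c = c'\<close>; the sum over the first then inverts \<open>G\<close> and forces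
  \<open>b = b'\<close>.\<close>

lemma LF_LF_inv: "kmat N LF * kmat N LF_inv = 1\<^sub>m (N * N)"
  unfolding kmat_mult one_mat_eq_kmat
proof (rule kmat_cong)
  fix b c b' c' :: int
  assume "b \<in> {0..<int N}" "c \<in> {0..<int N}" "b' \<in> {0..<int N}" "c' \<in> {0..<int N}"
  then have eq_iff: "int N dvd b' - b \<longleftrightarrow> b = b'" "int N dvd c - c' \<longleftrightarrow> c = c'"
    "int N dvd b - b' \<longleftrightarrow> b = b'"
    by (auto simp flip: mod_eq_dvd_iff)
  let ?R = "\<lambda>d. r ^ d"
  let ?K = "(inverse (of_nat (N * N)))\<^sup>2 * (\<mu> powi (c' + z) * inverse (\<mu> powi (c + z))) * inverse (phase 0 b c) * phase 0 b' c' :: complex"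
  have "(\<Sum>w<N. LF (int u) (int w) b' c' * LF_inv b c (int u) (int w)) =
      ?K * (of_nat (N * N) * of_bool (c = c')) * (dft f (b' - int u) * dft_dual f (b - int u))" for u
  proof -
    \<comment> \<open>The part of the phase depending on \<open>u\<close> cancels between the kernel
      and its inverse, which leaves \<open>?K\<close> constant in both sums.\<close>
    have ph: "phase (int u) b c = q powi (- (int u)\<^sup>2) * phase 0 b c" for b c
      by (simp flip: Q_add add: phase_def algebra_simps)
    have "LF (int u) (int w) b' c' * LF_inv b c (int u) (int w) =
        ?K * (dft f (b' - int u) * dft_dual f (b - int u)) *
        (dft ?R (1 * int w + (int u - c' - z)) * dft_dual ?R (1 * int w + (int u - c - z)))" for w
      unfolding LF_def LF_inv_def P_def G_def ph[of b c] ph[of b' c']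
      by (simp add: algebra_simps)
    then have "(\<Sum>w<N. LF (int u) (int w) b' c' * LF_inv b c (int u) (int w)) =
        ?K * (dft f (b' - int u) * dft_dual f (b - int u)) *
        (\<Sum>w<N. dft ?R (1 * int w + (int u - c' - z)) * dft_dual ?R (1 * int w + (int u - c - z)))"
      by (simp only: sum_distrib_left)
    also have "\<dots> = ?K * (dft f (b' - int u) * dft_dual f (b - int u)) * (of_nat (N * N) * of_bool (c = c'))"
      by (subst sum_dft_dft_dual) (simp_all add: eq_iff)
    finally show ?thesis by (simp only: mult_ac)
  qed
  then have "(\<Sum>u<N. \<Sum>w<N. LF (int u) (int w) b' c' * LF_inv b c (int u) (int w)) =
      ?K * (of_nat (N * N) * of_bool (c = c')) *
      (\<Sum>u<N. dft f (-1 * int u + b') * dft_dual f (-1 * int u + b))"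
    by (simp only: sum_distrib_left) simp
  also have "\<dots> = ?K * (of_nat (N * N) * of_bool (c = c')) * (of_nat (N * N) * of_bool (b = b'))"
    by (subst sum_dft_dft_dual) (simp_all add: eq_iff f_nonzero)
  also have "\<dots> = kdelta N b b' * kdelta N c c'"
    using N_pos by (auto simp: kdelta_def eq_iff power2_eq_square) (simp add: field_simps)
  finally show "(\<Sum>u<N. \<Sum>w<N. LF (int u) (int w) b' c' * LF_inv b c (int u) (int w)) =
    kdelta N b b' * kdelta N c c'" .
qed

lemma LF_inv_LF: "kmat N LF_inv * kmat N LF = 1\<^sub>m (N * N)"
  by (rule mat_mult_left_right_inverse[OF kmat_carrier kmat_carrier LF_LF_inv])

section \<open>The generators as weighted shifts\<close>

definition X :: "side \<Rightarrow> complex mat" where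
  "X s = (case s of
     Si \<Rightarrow> wshift N (\<lambda>s t. y Si * q powi (2 * t)) 1 0
   | Sj \<Rightarrow> wshift N (\<lambda>s t. y Sj * q powi (2 * s)) 0 0
   | Sk \<Rightarrow> wshift N (\<lambda>s t. y Sk) 0 1
   | Sl \<Rightarrow> wshift N (\<lambda>s t. y Sl * q powi (1 - 2 * t)) 0 (-1)
   | Sm \<Rightarrow> wshift N (\<lambda>s t. y Sm * q powi (1 - 2 * s)) (-1) 0)"

definition X' :: "side \<Rightarrow> complex mat" where
  "X' s = (case s of
     Si \<Rightarrow> wshift N (\<lambda>s t. v Si * q powi (1 - 2 * s)) (-1) 1
   | Sj \<Rightarrow> wshift N (\<lambda>s t. v Sj * q powi (2 * s)) 0 0
   | Sk \<Rightarrow> wshift N (\<lambda>s t. v Sk) 1 0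
   | Sl \<Rightarrow> wshift N (\<lambda>s t. v Sl * q powi (1 - 2 * t)) 0 (-1)
   | Sm \<Rightarrow> wshift N (\<lambda>s t. v Sm * q powi (2 * t)) 0 0)"

lemma X_carrier [simp]: "X s \<in> carrier_mat (N * N) (N * N)" "X' s \<in> carrier_mat (N * N) (N * N)"
  by (cases s; simp add: X_def X'_def)+

lemma X_dim [simp]:
  "dim_row (X s) = N * N" "dim_col (X s) = N * N" "dim_row (X' s) = N * N" "dim_col (X' s) = N * N"
  using X_carrier[of s] by (simp_all only: carrier_matD)

lemma X_tensor:
  "X Si = y Si \<cdot>\<^sub>m (B2 N \<otimes>\<^sub>m B1 N q)"
  "X Sj = y Sj \<cdot>\<^sub>m (B1 N q \<otimes>\<^sub>m 1\<^sub>m N)"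
  "X Sk = y Sk \<cdot>\<^sub>m (1\<^sub>m N \<otimes>\<^sub>m B2 N)"
  "X Sl = y Sl \<cdot>\<^sub>m (1\<^sub>m N \<otimes>\<^sub>m B3 N q)"
  "X Sm = y Sm \<cdot>\<^sub>m (B3 N q \<otimes>\<^sub>m 1\<^sub>m N)"
  by (simp_all add: X_def B1_eq_monomial_mat B2_eq_monomial_mat B3_eq_monomial_mat
    one_mat_eq_monomial_mat smult_tensor_monomial_mat)

lemma X'_tensor:
  "X' Si = v Si \<cdot>\<^sub>m (B3 N q \<otimes>\<^sub>m B2 N)"
  "X' Sj = v Sj \<cdot>\<^sub>m (B1 N q \<otimes>\<^sub>m 1\<^sub>m N)"
  "X' Sk = v Sk \<cdot>\<^sub>m (B2 N \<otimes>\<^sub>m 1\<^sub>m N)"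
  "X' Sl = v Sl \<cdot>\<^sub>m (1\<^sub>m N \<otimes>\<^sub>m B3 N q)"
  "X' Sm = v Sm \<cdot>\<^sub>m (1\<^sub>m N \<otimes>\<^sub>m B1 N q)"
  by (simp_all add: X'_def B1_eq_monomial_mat B2_eq_monomial_mat B3_eq_monomial_mat
    one_mat_eq_monomial_mat smult_tensor_monomial_mat)

lemma LF_shift_periodic: "LF s t b (c + int N - i) = LF s t b (c - i)"
  using LF_periodic(4)[of s t b "c - i"] by (simp add: algebra_simps)

lemma kmat_LF_mult_wshift:
  "kmat N LF * wshift N g i j = kmat N (\<lambda>s t b c. g s t * LF (s + i) (t + j) b c)"
  by (rule kmat_mult_wshift[OF N_pos]) (simp add: per2_def LF_periodic)

lemma kmat_X_mult:
  assumes F: "\<And>s t. per2 N (F s t)"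
  shows "X Si * kmat N F = kmat N (\<lambda>s t b c. y Si * q powi (2 * c) * F s t (b - 1) c)"
    and "X Sj * kmat N F = kmat N (\<lambda>s t b c. y Sj * q powi (2 * b) * F s t b c)"
    and "X Sk * kmat N F = kmat N (\<lambda>s t b c. y Sk * F s t b (c - 1))"
    and "X Sl * kmat N F = kmat N (\<lambda>s t b c. y Sl * q powi (1 - 2 * (c + 1)) * F s t b (c + 1))"
    and "X Sm * kmat N F = kmat N (\<lambda>s t b c. y Sm * q powi (1 - 2 * (b + 1)) * F s t (b + 1) c)"
  unfolding X_def side.case
  by (subst wshift_mult_kmat[OF N_pos _ F]; simp add: per2_def Q_periodic')+

text \<open>The entrywise identities for \<open>LF\<close> in matrix form. For \<open>Sk\<close> and
  \<open>Sm\<close> the factor \<open>1 + q X_i\<^sup>-\<^sup>1\<close> has been multiplied by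
  \<open>X_i\<close>; the bracketing lets the shifts act one at a time on a kernel.\<close>

lemma X_relations:
  "X Si * (kmat N LF * X' Si) = kmat N LF"
  "kmat N LF * X' Sj = X Sj * kmat N LF + q \<cdot>\<^sub>m (X Si * (X Sj * kmat N LF))"
  "X Si * (kmat N LF * X' Sk) + q \<cdot>\<^sub>m (kmat N LF * X' Sk) = X Si * (X Sk * kmat N LF)"
  "kmat N LF * X' Sl = X Sl * kmat N LF + q \<cdot>\<^sub>m (X Si * (X Sl * kmat N LF))"
  "X Si * (kmat N LF * X' Sm) + q \<cdot>\<^sub>m (kmat N LF * X' Sm) = X Si * (X Sm * kmat N LF)"
proof -
  have per: "per2 N (LF s t)" for s t
    by (simp add: per2_def LF_periodic)
  have shift: "n + int N + 1 = (n + 1) + int N" for n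
    by simp
  have per_Sl: "per2 N (\<lambda>b c. y Sl * q powi (1 - 2 * (c + 1)) * LF s t b (c + 1))"
    and per_Sm: "per2 N (\<lambda>b c. y Sm * q powi (1 - 2 * (b + 1)) * LF s t (b + 1) c)" for s t
    unfolding per2_def shift by (simp_all only: LF_periodic Q_periodic simp_thms)
  note XM = kmat_X_mult[of LF, OF per]
  have MX: "kmat N LF * X' Si = kmat N (\<lambda>s t b c. v Si * q powi (1 - 2 * s) * LF (s - 1) (t + 1) b c)"
    "kmat N LF * X' Sj = kmat N (\<lambda>s t b c. v Sj * q powi (2 * s) * LF s t b c)"
    "kmat N LF * X' Sk = kmat N (\<lambda>s t b c. v Sk * LF (s + 1) t b c)"
    "kmat N LF * X' Sl = kmat N (\<lambda>s t b c. v Sl * q powi (1 - 2 * t) * LF s (t - 1) b c)"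
    "kmat N LF * X' Sm = kmat N (\<lambda>s t b c. v Sm * q powi (2 * t) * LF s t b c)"
    by (simp_all add: X'_def kmat_LF_mult_wshift)
  show "X Si * (kmat N LF * X' Si) = kmat N LF"
    unfolding MX by (subst kmat_X_mult) (simp_all add: per2_def LF_periodic LF_Xi)
  show "kmat N LF * X' Sj = X Sj * kmat N LF + q \<cdot>\<^sub>m (X Si * (X Sj * kmat N LF))"
    unfolding MX XM by (subst kmat_X_mult)
      (simp_all add: per2_def LF_periodic Q_periodic' kmat_add kmat_smult LF_Xj)
  show "X Si * (kmat N LF * X' Sk) + q \<cdot>\<^sub>m (kmat N LF * X' Sk) = X Si * (X Sk * kmat N LF)"
    unfolding MX XM by (subst kmat_X_mult, simp add: per2_def LF_periodic, subst kmat_X_mult)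
      (simp_all add: per2_def LF_periodic LF_shift_periodic kmat_add kmat_smult LF_Xk)
  show "kmat N LF * X' Sl = X Sl * kmat N LF + q \<cdot>\<^sub>m (X Si * (X Sl * kmat N LF))"
    unfolding MX XM
    by (subst kmat_X_mult(1), rule per_Sl) (simp add: kmat_add kmat_smult LF_Xl)
  show "X Si * (kmat N LF * X' Sm) + q \<cdot>\<^sub>m (kmat N LF * X' Sm) = X Si * (X Sm * kmat N LF)"
    unfolding MX XM
    by (subst kmat_X_mult(1), simp add: per2_def LF_periodic, subst kmat_X_mult(1), rule per_Sm)
      (simp add: kmat_add kmat_smult LF_Xm)
qed

end

text \<open>For square matrices a one-sided inverse is two-sided, so a single product determines the
  ring inverse.\<close>

lemma ring_mat_inv:
  assumes A: "(A :: complex mat) \<in> carrier_mat n n" and B: "B \<in> carrier_mat n n" and AB: "A * B = 1\<^sub>m n"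
  shows "A \<in> Units (ring_mat TYPE(complex) n ())" and "inv\<^bsub>ring_mat TYPE(complex) n ()\<^esub> A = B"
proof -
  interpret ring "ring_mat TYPE(complex) n ()" by (rule ring_mat)
  have BA: "B * A = 1\<^sub>m n" by (rule mat_mult_left_right_inverse[OF A B AB])
  show "A \<in> Units (ring_mat TYPE(complex) n ())"
    using A B AB BA by (auto simp: Units_def ring_mat_simps)
  show "inv\<^bsub>ring_mat TYPE(complex) n ()\<^esub> A = B"
    by (rule inv_unique'[symmetric]) (use A B AB BA in \<open>simp_all add: ring_mat_simps\<close>)
qed

lemma smult_smult_mat: "a \<cdot>\<^sub>m (b \<cdot>\<^sub>m A) = (a * b :: complex) \<cdot>\<^sub>m A"
  by (rule eq_matI) auto

text \<open>Any matrix has a periodic kernel, obtained by reducing the indices modulo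
  \<open>N\<close>. This makes the shift rules available for an arbitrary commuting matrix.\<close>

lemma kmat_entries:
  assumes N: "N > 0" and T: "T \<in> carrier_mat (N * N) (N * N)"
  obtains F where "T = kmat N F" "\<And>s t. per2 N (F s t)" "\<And>b c. per2 N (\<lambda>s t. F s t b c)"
proof
  define i where "i u w = nat (u mod int N) * N + nat (w mod int N)" for u w
  have [simp]: "i (u + int N) w = i u w" "i u (w + int N) = i u w" for u w
    by (simp_all add: i_def)
  have [simp]: "i (int (k div N)) (int (k mod N)) = k" if "k < N * N" for k
    using that N by (simp add: i_def less_mult_imp_div_less)
  let ?F = "\<lambda>s t b c. T $$ (i b c, i s t)"
  show "T = kmat N ?F"
    using T by (intro eq_matI) (auto simp: kmat_def)
  show "per2 N (?F s t)" "per2 N (\<lambda>s t. ?F s t b c)" for s t b c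
    by (simp_all add: per2_def)
qed

lemma kmat_eqD:
  assumes "kmat N F = kmat N G" and "s < N" "t < N" "b < N" "c < N"
  shows "F (int s) (int t) (int b) (int c) = G (int s) (int t) (int b) (int c)"
proof -
  have "kmat N H $$ (b * N + c, s * N + t) = H (int s) (int t) (int b) (int c)" for H
    using assms mult_add_less_square[of b N c] mult_add_less_square[of s N t] by (simp add: kmat_def)
  then show ?thesis using assms(1) by metis
qed

section \<open>Schur's lemma and the classification of intertwiners\<close>

context square_flip
begin

text \<open>\<open>X' Sj\<close> and \<open>X' Sm\<close> separate the first and the second basis
  index, so \<open>T\<close> is diagonal; \<open>X' Sk\<close> and \<open>X' Sl\<close> move these
  indices one at a time and equate the diagonal entries.\<close>

lemma commutant_X'_scalar:
  assumes T: "T \<in> carrier_mat (N * N) (N * N)" and comm: "\<And>s. T * X' s = X' s * T"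
  shows "\<exists>a. T = a \<cdot>\<^sub>m 1\<^sub>m (N * N)"
proof -
  obtain F where TF: "T = kmat N F" and per: "\<And>s t. per2 N (F s t)" "\<And>b c. per2 N (\<lambda>s t. F s t b c)"
    using kmat_entries[OF N_pos T] by blast
  note mult = kmat_mult_wshift[OF N_pos, of F, OF per(2)] wshift_mult_kmat[OF N_pos _ per(1)]
  have j: "kmat N (\<lambda>s t b c. v Sj * q powi (2 * s) * F s t b c) = kmat N (\<lambda>s t b c. v Sj * q powi (2 * b) * F s t b c)"
    and m: "kmat N (\<lambda>s t b c. v Sm * q powi (2 * t) * F s t b c) = kmat N (\<lambda>s t b c. v Sm * q powi (2 * c) * F s t b c)"
    and k: "kmat N (\<lambda>s t b c. v Sk * F (s + 1) t b c) = kmat N (\<lambda>s t b c. v Sk * F s t (b - 1) c)"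
    and l: "kmat N (\<lambda>s t b c. v Sl * q powi (1 - 2 * t) * F s (t - 1) b c) =
      kmat N (\<lambda>s t b c. v Sl * q powi (1 - 2 * (c + 1)) * F s t b (c + 1))"
    using comm[of Sj] comm[of Sm] comm[of Sk] comm[of Sl]
    by (simp_all add: TF X'_def mult per2_def Q_periodic')
  have off: "F (int s) (int t) (int b) (int c) = 0"
    if "s < N" "t < N" "b < N" "c < N" "s \<noteq> b \<or> t \<noteq> c" for s t b c
    using kmat_eqD[OF j that(1-4)] kmat_eqD[OF m that(1-4)] that Q_inj[of s b] Q_inj[of t c] by auto
  have diag_s: "F (int s) (int t) (int s) (int t) = F 0 (int t) 0 (int t)" if "s < N" "t < N" for s t
    using that
  proof (induction s)
    case (Suc s)
    then show ?case using kmat_eqD[OF k, of s t "Suc s" t] by (simp add: add.commute)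
  qed simp
  have diag_t: "F 0 (int t) 0 (int t) = F 0 0 0 0" if "t < N" for t
    using that
  proof (induction t)
    case (Suc t)
    \<comment> \<open>With column \<open>(0, Suc t)\<close> and row \<open>(0, t)\<close> both
      weights are \<open>q powi (1 - 2 * (int t + 1))\<close> and cancel.\<close>
    then show ?case using kmat_eqD[OF l, of 0 "Suc t" 0 t] N_pos by (simp add: add.commute)
  qed simp
  have "kmat N F = kmat N (\<lambda>s t b c. F 0 0 0 0 * (kdelta N s b * kdelta N t c))"
  proof (rule kmat_cong)
    fix s t b c :: int
    assume "s \<in> {0..<int N}" "t \<in> {0..<int N}" "b \<in> {0..<int N}" "c \<in> {0..<int N}"
    then obtain s' t' b' c' where nat: "s = int s'" "t = int t'" "b = int b'" "c = int c'"
      "s' < N" "t' < N" "b' < N" "c' < N"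
      by (metis atLeastLessThan_iff nonneg_int_cases of_nat_less_iff)
    then have "kdelta N s b = of_bool (s' = b')" "kdelta N t c = of_bool (t' = c')"
      by (auto simp: kdelta_def simp flip: mod_eq_dvd_iff)
    then show "F s t b c = F 0 0 0 0 * (kdelta N s b * kdelta N t c)"
      using nat off[of s' t' b' c'] diag_s[of s' t'] diag_t[of t'] by auto
  qed
  then show ?thesis
    by (auto simp: TF one_mat_eq_kmat kmat_smult)
qed

text \<open>The first relation identifies the conjugate of \<open>X' Si\<close> with the inverse of
  \<open>X Si\<close>. The relations for \<open>Sj\<close> and \<open>Sl\<close> then give the
  conjugates directly, those for \<open>Sk\<close> and \<open>Sm\<close> after cancelling
  \<open>X Si\<close>.\<close>

lemma flip_ops_eq_conj:
  assumes \<rho>: "cf_hom q square (N * N) \<rho>" and gen: "\<And>s. \<rho> (cf_gen q square s) = X s"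
  shows "flip_ops N q \<rho> s = kmat N LF * X' s * kmat N LF_inv"
proof -
  let ?n = "N * N"
  define M M' where "M = kmat N LF" and "M' = kmat N LF_inv"
  define A where "A s = M * X' s * M'" for s
  have MC: "M \<in> carrier_mat ?n ?n" "M' \<in> carrier_mat ?n ?n" and MM': "M * M' = 1\<^sub>m ?n"
    by (simp_all add: M_def M'_def LF_LF_inv)
  have AC [simp]: "A s \<in> carrier_mat ?n ?n" for s
    using MC by (simp add: A_def mult_carrier_mat[of _ ?n ?n _ ?n])
  have AD [simp]: "dim_row (A s) = ?n" "dim_col (A s) = ?n" for s
    using AC[of s] by (simp_all only: carrier_matD)
  note carr = MC AC X_carrier mult_carrier_mat[of _ ?n ?n _ ?n]
  note assoc = assoc_mult_mat[of _ ?n ?n _ ?n _ ?n]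
  have conj: "M * X' s * M' = A s" "B * (M * X' s) * M' = B * A s" "B * M * M' = B"
    if "B \<in> carrier_mat ?n ?n" for B s
    using that by (simp_all add: carr A_def assoc MM')
  have XiAi: "X Si * A Si = 1\<^sub>m ?n"
    using arg_cong[OF X_relations(1), of "\<lambda>B. B * M'"] MC
    by (simp add: conj MM' flip: M_def)
  have AiXi: "A Si * X Si = 1\<^sub>m ?n"
    by (rule mat_mult_left_right_inverse[OF _ _ XiAi]) simp_all
  \<comment> \<open>The inverse is the image under \<open>\<rho>\<close> of the letter
    \<open>Neg s\<close>.\<close>
  have X_inv: "\<exists>Y\<in>carrier_mat ?n ?n. X s * Y = 1\<^sub>m ?n" for s
    using cf_hom_Pos_Neg[OF \<rho>, of s] cf_hom_carrier[OF \<rho>] gen by (metis (no_types, lifting))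
  define E where "E = 1\<^sub>m ?n + q \<cdot>\<^sub>m A Si"
  have EC: "E \<in> carrier_mat ?n ?n" by (simp add: E_def)
  have plus: "A s = (1\<^sub>m ?n + q \<cdot>\<^sub>m X Si) * X s"
    if "M * X' s = X s * M + q \<cdot>\<^sub>m (X Si * (X s * M))" for s
  proof -
    have "A s = (X s * M + q \<cdot>\<^sub>m (X Si * (X s * M))) * M'"
      by (simp add: A_def that)
    also have "\<dots> = X s * M * M' + q \<cdot>\<^sub>m (X Si * (X s * M) * M')"
      by (simp add: carr add_mult_distrib_mat[of _ ?n ?n _ _ ?n] mult_smult_assoc_mat[of _ ?n ?n _ ?n])
    also have "\<dots> = X s + q \<cdot>\<^sub>m (X Si * X s)"
      using MM' by (simp add: carr assoc)
    also have "\<dots> = (1\<^sub>m ?n + q \<cdot>\<^sub>m X Si) * X s"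
      by (simp add: carr add_mult_distrib_mat[of _ ?n ?n _ _ ?n] mult_smult_assoc_mat[of _ ?n ?n _ ?n])
    finally show ?thesis .
  qed
  have minus: "inv\<^bsub>End2 N\<^esub> E * X s = A s"
    if rel: "X Si * (M * X' s) + q \<cdot>\<^sub>m (M * X' s) = X Si * (X s * M)" for s
  proof -
    have "(X Si * (M * X' s) + q \<cdot>\<^sub>m (M * X' s)) * M' = X Si * A s + q \<cdot>\<^sub>m A s"
      by (simp add: carr A_def assoc add_mult_distrib_mat[of _ ?n ?n _ _ ?n] mult_smult_assoc_mat[of _ ?n ?n _ ?n])
    moreover have "X Si * (X s * M) * M' = X Si * X s"
      using MM' by (simp add: carr assoc)
    ultimately have "X Si * A s + q \<cdot>\<^sub>m A s = X Si * X s"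
      using rel by simp
    then have "A Si * (X Si * A s + q \<cdot>\<^sub>m A s) = A Si * (X Si * X s)"
      by simp
    moreover have "A Si * (X Si * B) = B" if "B \<in> carrier_mat ?n ?n" for B
      using that AiXi by (simp add: carr flip: assoc)
    moreover have "A Si * (X Si * A s + q \<cdot>\<^sub>m A s) = A Si * (X Si * A s) + q \<cdot>\<^sub>m (A Si * A s)"
      by (simp add: carr mult_add_distrib_mat[of _ ?n ?n _ ?n] mult_smult_distrib[of _ ?n ?n _ ?n])
    ultimately have "A s + q \<cdot>\<^sub>m (A Si * A s) = X s"
      by simp
    then have EA: "E * A s = X s"
      by (simp add: carr E_def add_mult_distrib_mat[of _ ?n ?n _ _ ?n] mult_smult_assoc_mat[of _ ?n ?n _ ?n])
    obtain Y where Y: "Y \<in> carrier_mat ?n ?n" "X s * Y = 1\<^sub>m ?n" using X_inv by blast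
    have YX: "Y * X s = 1\<^sub>m ?n"
      by (rule mat_mult_left_right_inverse[OF _ Y]) simp
    \<comment> \<open>Invertibility of the denominator \<open>E\<close> follows from
      \<open>E * A s = X s\<close> and the invertibility of \<open>X s\<close>.\<close>
    have "E * (A s * Y) = 1\<^sub>m ?n"
      using EC Y EA by (simp add: carr flip: assoc)
    then have "inv\<^bsub>End2 N\<^esub> E = A s * Y"
      using EC Y by (intro ring_mat_inv(2)) auto
    then show ?thesis
      using Y YX by (simp add: carr assoc)
  qed
  have inv_Xi: "inv\<^bsub>End2 N\<^esub> (X Si) = A Si"
    by (rule ring_mat_inv(2)[OF _ _ XiAi]) simp_all
  have "flip_ops N q \<rho> s = A s"
    using plus[of Sj] plus[of Sl] minus[of Sk] minus[of Sm] X_relations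
    by (cases s) (simp_all add: flip_ops_def Let_def gen inv_Xi M_def E_def)
  then show ?thesis by (simp add: A_def M_def M'_def)
qed

text \<open>Scalars cancel under conjugation. Conversely, two intertwiners differ by a matrix
  commuting with all \<open>X' s\<close>, which \<open>commutant_X'_scalar\<close> makes
  scalar.\<close>

lemma intertwiner_iff:
  assumes L: "L \<in> carrier_mat (N * N) (N * N)"
    and \<rho>': "cf_hom q square' (N * N) \<rho>'" and gen: "\<And>s. \<rho>' (cf_gen q square' s) = X' s"
  shows "L \<in> Units (End2 N) \<and> (\<forall>X'\<in>carrier (cf_algebra q square').
      L * \<rho>' X' * inv\<^bsub>End2 N\<^esub> L = kmat N LF * \<rho>' X' * kmat N LF_inv) \<longleftrightarrow>
    (\<exists>\<kappa>. \<kappa> \<noteq> 0 \<and> L = \<kappa> \<cdot>\<^sub>m kmat N LF)"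
    (is "?intertwines \<longleftrightarrow> ?multiple")
proof
  let ?n = "N * N"
  define M M' where "M = kmat N LF" and "M' = kmat N LF_inv"
  have MC: "M \<in> carrier_mat ?n ?n" "M' \<in> carrier_mat ?n ?n" and MM': "M * M' = 1\<^sub>m ?n" and M'M: "M' * M = 1\<^sub>m ?n"
    by (simp_all add: M_def M'_def LF_LF_inv LF_inv_LF)
  note carr = MC L X_carrier mult_carrier_mat[of _ ?n ?n _ ?n]
  note assoc = assoc_mult_mat[of _ ?n ?n _ ?n _ ?n]
  {
    assume ?multiple
    then obtain \<kappa> where \<kappa>: "\<kappa> \<noteq> 0" "L = \<kappa> \<cdot>\<^sub>m M" by (auto simp: M_def)
    have "L * (inverse \<kappa> \<cdot>\<^sub>m M') = 1\<^sub>m ?n"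
      using \<kappa> MC MM' by (simp add: mult_smult_assoc_mat[of _ ?n ?n _ ?n] mult_smult_distrib[of _ ?n ?n _ ?n] one_smult_mat smult_smult_mat)
    then have inv: "L \<in> Units (End2 N)" "inv\<^bsub>End2 N\<^esub> L = inverse \<kappa> \<cdot>\<^sub>m M'"
      using L MC ring_mat_inv[of L ?n "inverse \<kappa> \<cdot>\<^sub>m M'"] by simp_all
    moreover have "L * B * (inverse \<kappa> \<cdot>\<^sub>m M') = M * B * M'" if "B \<in> carrier_mat ?n ?n" for B
      using that \<kappa> by (simp add: carr mult_smult_assoc_mat[of _ ?n ?n _ ?n] mult_smult_distrib[of _ ?n ?n _ ?n] one_smult_mat smult_smult_mat)
    ultimately show ?intertwines
      using cf_hom_carrier[OF \<rho>'] by (auto simp: carrier_cf_algebra M_def M'_def)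
  next
    assume tw: ?intertwines
    interpret E: ring "End2 N" by (rule ring_mat)
    define L' where "L' = inv\<^bsub>End2 N\<^esub> L"
    have L': "L' \<in> carrier_mat ?n ?n" "L' * L = 1\<^sub>m ?n" "L * L' = 1\<^sub>m ?n"
      using tw E.Units_inv_closed[of L] E.Units_l_inv[of L] E.Units_r_inv[of L]
      by (simp_all add: L'_def ring_mat_simps)
    have conj: "L * X' s * L' = M * X' s * M'" for s
    proof -
      have "cf_gen q square' s \<in> carrier (cf_algebra q square')"
        by (simp add: cf_gen_def)
      then show ?thesis using tw gen unfolding L'_def M_def M'_def by metis
    qed
    have "(M' * L) * X' s = X' s * (M' * L)" for s
    proof -
      have "(M' * L) * X' s = M' * (L * X' s * L') * L"
        using L' by (simp add: carr assoc)
      also have "\<dots> = (M' * M) * X' s * (M' * L)"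
        unfolding conj by (simp add: carr assoc)
      finally show ?thesis using M'M by (simp add: carr)
    qed
    then obtain a where a: "M' * L = a \<cdot>\<^sub>m 1\<^sub>m ?n"
      using commutant_X'_scalar[of "M' * L"] carr by auto
    have "L = (M * M') * L" using MM' L by simp
    also have "\<dots> = M * (M' * L)" by (simp add: carr assoc)
    also have "\<dots> = a \<cdot>\<^sub>m M"
      unfolding a using MC by (simp add: mult_smult_distrib[of _ ?n ?n _ ?n])
    finally have La: "L = a \<cdot>\<^sub>m M" .
    moreover have "a \<noteq> 0"
    \<comment> \<open>With \<open>a = 0\<close> the product of \<open>L\<close> and its inverse
      would vanish, contradicting the entry 1 of the identity at \<open>(0, 0)\<close>.\<close>
    proof
      assume "a = 0"
      then have "L * L' = 0 \<cdot>\<^sub>m (M * L')"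
        using La MC L' by (simp only: mult_smult_assoc_mat[of _ ?n ?n _ ?n])
      then have "(0 \<cdot>\<^sub>m (M * L')) $$ (0, 0) = 1\<^sub>m ?n $$ (0, 0)"
        using L'(3) by simp
      then show False using MC L' N_pos by simp
    qed
    ultimately show ?multiple by (auto simp: M_def)
  }
qed

end

section \<open>The explicit intertwiner and its uniqueness up to scale\<close>

theorem proposition2p4:
  fixes N :: nat and q :: complex and x y v :: "side \<Rightarrow> complex" and z :: int
    and \<rho> \<rho>' :: "side free_alg set \<Rightarrow> complex mat"
  assumes N: "N \<ge> 1"
    and q: "q ^ N = (-1) ^ (N + 1)" "(q\<^sup>2) ^ N = 1" "\<forall>k. 0 < k \<and> k < N \<longrightarrow> (q\<^sup>2) ^ k \<noteq> 1"
    and y: "\<forall>s. y s \<noteq> 0"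
    and x: "\<forall>s. x s = y s ^ N" "x Si \<noteq> -1"
    and v: "\<forall>s. v s \<noteq> 0"
      "v Si ^ N = inverse (x Si)"
      "v Sj ^ N = (1 + x Si) * x Sj"
      "v Sk ^ N = inverse (1 + inverse (x Si)) * x Sk"
      "v Sl ^ N = (1 + x Si) * x Sl"
      "v Sm ^ N = inverse (1 + inverse (x Si)) * x Sm"
      "y Si * y Sj * y Sk * y Sl * y Sm = v Si * v Sj * v Sk * v Sl * v Sm"
    and z: "v Si = q powi (2 * z) * inverse (y Si)"
    and \<rho>: "cf_hom q square (N * N) \<rho>"
      "\<rho> (cf_gen q square Si) = y Si \<cdot>\<^sub>m (B2 N \<otimes>\<^sub>m B1 N q)"
      "\<rho> (cf_gen q square Sj) = y Sj \<cdot>\<^sub>m (B1 N q \<otimes>\<^sub>m 1\<^sub>m N)"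
      "\<rho> (cf_gen q square Sk) = y Sk \<cdot>\<^sub>m (1\<^sub>m N \<otimes>\<^sub>m B2 N)"
      "\<rho> (cf_gen q square Sl) = y Sl \<cdot>\<^sub>m (1\<^sub>m N \<otimes>\<^sub>m B3 N q)"
      "\<rho> (cf_gen q square Sm) = y Sm \<cdot>\<^sub>m (B3 N q \<otimes>\<^sub>m 1\<^sub>m N)"
    and \<rho>': "cf_hom q square' (N * N) \<rho>'"
      "\<rho>' (cf_gen q square' Si) = v Si \<cdot>\<^sub>m (B3 N q \<otimes>\<^sub>m B2 N)"
      "\<rho>' (cf_gen q square' Sj) = v Sj \<cdot>\<^sub>m (B1 N q \<otimes>\<^sub>m 1\<^sub>m N)"
      "\<rho>' (cf_gen q square' Sk) = v Sk \<cdot>\<^sub>m (B2 N \<otimes>\<^sub>m 1\<^sub>m N)"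
      "\<rho>' (cf_gen q square' Sl) = v Sl \<cdot>\<^sub>m (1\<^sub>m N \<otimes>\<^sub>m B3 N q)"
      "\<rho>' (cf_gen q square' Sm) = v Sm \<cdot>\<^sub>m (1\<^sub>m N \<otimes>\<^sub>m B1 N q)"
  shows "cf_hom q square' (N * N) (rho_Phi N q \<rho>) \<and>
    (\<forall>s. rho_Phi N q \<rho> (cf_gen q square' s) = flip_ops N q \<rho> s) \<and>
    (\<forall>L \<in> carrier (End2 N).
      L \<in> Units (End2 N) \<and>
      (\<forall>X' \<in> carrier (cf_algebra q square'). L * \<rho>' X' * inv\<^bsub>End2 N\<^esub> L = rho_Phi N q \<rho> X')
      \<longleftrightarrow>
      (\<exists>\<kappa>. \<kappa> \<noteq> 0 \<and> (\<forall>s<N. \<forall>t<N.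
        L *\<^sub>v (unit_vec N s \<otimes>\<^sub>v unit_vec N t) =
        \<kappa> \<cdot>\<^sub>v finsum_vec TYPE(complex) (N * N)
          (\<lambda>(b, c). L_coeff N q y v z s t b c \<cdot>\<^sub>v (unit_vec N b \<otimes>\<^sub>v unit_vec N c))
          ({..<N} \<times> {..<N}))))"
proof -
  have y_Si: "y Si ^ N \<noteq> -1" using x by simp
  interpret square_flip N q y v z
    by unfold_locales (use N q y x v z in auto)
  have gen: "\<rho> (cf_gen q square s) = X s" "\<rho>' (cf_gen q square' s) = X' s" for s
    by (cases s; simp add: X_tensor X'_tensor \<rho> \<rho>')+
  \<comment> \<open>This conjugate of \<open>\<rho>'\<close> is already a homomorphism; since its
    generators take the values \<open>flip_ops\<close>, it is the lift defining
    \<open>rho_Phi\<close>.\<close>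
  define R where "R = (\<lambda>Y\<in>carrier (cf_algebra q square'). kmat N LF * \<rho>' Y * kmat N LF_inv)"
  have R: "cf_hom q square' (N * N) R"
    unfolding R_def by (rule cf_hom_conj[OF \<rho>'(1)]) (simp_all add: LF_LF_inv LF_inv_LF)
  have R_gen: "R (cf_gen q square' s) = flip_ops N q \<rho> s" for s
    using flip_ops_eq_conj[OF \<rho>(1) gen(1)] gen(2) by (simp add: R_def cf_gen_def)
  have "rho_Phi N q \<rho> = R"
    unfolding rho_Phi_def by (rule cf_lift_eq[OF _ R R_gen]) (simp only: R_def restrict_extensional)
  moreover have "L \<in> Units (End2 N) \<and>
      (\<forall>Y\<in>carrier (cf_algebra q square'). L * \<rho>' Y * inv\<^bsub>End2 N\<^esub> L = R Y) \<longleftrightarrow>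
      (\<exists>\<kappa>. \<kappa> \<noteq> 0 \<and> (\<forall>s<N. \<forall>t<N. L *\<^sub>v (unit_vec N s \<otimes>\<^sub>v unit_vec N t) =
        \<kappa> \<cdot>\<^sub>v finsum_vec TYPE(complex) (N * N)
          (\<lambda>(b, c). L_coeff N q y v z s t b c \<cdot>\<^sub>v (unit_vec N b \<otimes>\<^sub>v unit_vec N c))
          ({..<N} \<times> {..<N})))"
    if "L \<in> carrier (End2 N)" for L
  proof -
    have L: "L \<in> carrier_mat (N * N) (N * N)" using that by (simp add: ring_mat_simps)
    show ?thesis
      using intertwiner_iff[OF L \<rho>'(1) gen(2)]
      unfolding eq_smult_kmat_iff_columns[OF L, of "L_coeff N q y v z", OF L_coeff_eq_LF]
      by (simp add: R_def)
  qed
  ultimately show ?thesis using R R_gen by simp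
qed

end
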